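(* Let $\mathcal H$ be a real Hilbert space, let $f:\mathcal H\to\mathbb R\cup\{+\infty\}$ be proper, convex and lower semicontinuous with $\operatorname{argmin}_{\mathcal H} f\neq\emptyset$, and let $\alpha>0$, $\beta>0$. Let $t_0>0$ be an arbitrary starting time. Suppose $\delta:[t_0,+\infty)\to(0,+\infty)$ and $\gamma:[t_0,+\infty)\to(0,+\infty)$ are continuously differentiable functions. Then, given any pair $(x_0,v_0)\in\mathcal H^2$, there exists a unique solution trajectory $x\in W^{1,1}_{loc}([t_0,+\infty))$ that satisfies $$\ddot x(t)+\frac{\alpha}{t}\dot x(t)+\beta\,\frac{\mathrm d}{\mathrm dt}\Big[\delta(t)\nabla f_{\gamma(t)}(x(t))\Big]+\Big(1+\frac{\beta}{t}\Big)\delta(t)\nabla f_{\gamma(t)}(x(t))=0$$ almost everywhere on $[t_0,+\infty)$, with the initial condition $(x(t_0),\dot x(t_0))=(x_0,v_0)$.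
   Context: For $\lambda>0$, $f_\lambda$ denotes the Moreau envelope $f_\lambda(x)=\min_{y\in\mathcal H}\{f(y)+\frac1{2\lambda}\|x-y\|^2\}$; it is convex and $C^1$, with $\frac1\lambda$-Lipschitz gradient $\nabla f_\lambda(x)=\frac1\lambda(x-\operatorname{prox}_{\lambda f}(x))$, where $\operatorname{prox}_{\lambda f}(x)$ is the unique minimizer in the definition of $f_\lambda(x)$. The trajectory $x$ takes values in $\mathcal H$, and $x\in W^{1,1}_{loc}([t_0,+\infty))$ means that $x$ is locally absolutely continuous on $[t_0,+\infty)$. *)

theory Defs
  imports "HOL-Analysis.Analysis"
begin

definition proper_fun :: "('a \<Rightarrow> ereal) \<Rightarrow> bool" where
  "proper_fun f \<longleftrightarrow> (\<forall>x. f x \<noteq> -\<infinity>) \<and> (\<exists>x. f x \<noteq> \<infinity>)"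

(* Meaningful for functions that never take the value -\<infinity>; ereal 0 * \<infinity> = 0 in the library,
   so the end points u = 0 and u = 1 impose nothing. *)
definition convex_fun :: "('a::real_vector \<Rightarrow> ereal) \<Rightarrow> bool" where
  "convex_fun f \<longleftrightarrow>
     (\<forall>x y. \<forall>u\<in>{0..1::real}. f ((1 - u) *\<^sub>R x + u *\<^sub>R y) \<le> ereal (1 - u) * f x + ereal u * f y)"

definition lsc_fun :: "('a::topological_space \<Rightarrow> ereal) \<Rightarrow> bool" where
  "lsc_fun f \<longleftrightarrow> (\<forall>x. f x \<le> Liminf (at x) f)"

definition argmin :: "('a \<Rightarrow> ereal) \<Rightarrow> 'a set" where
  "argmin f = {x. is_arg_min f (\<lambda>_. True) x}"

(* For proper, convex, lower semicontinuous f on a Hilbert space and \<mu> > 0 the infimum is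
   attained and finite, so that passing to real values loses nothing. *)
definition moreau_env :: "('a::real_inner \<Rightarrow> ereal) \<Rightarrow> real \<Rightarrow> 'a \<Rightarrow> real" where
  "moreau_env f \<mu> x = real_of_ereal (INF y. f y + ereal (1 / (2 * \<mu>) * (norm (x - y))\<^sup>2))"

definition gradient :: "('a::real_inner \<Rightarrow> real) \<Rightarrow> 'a \<Rightarrow> 'a" where
  "gradient g x = (THE d. GDERIV g x :> d)"

definition cont_differentiable_on :: "real set \<Rightarrow> (real \<Rightarrow> real) \<Rightarrow> bool" where
  "cont_differentiable_on S g \<longleftrightarrow>
     (\<exists>g'. (\<forall>t\<in>S. (g has_real_derivative g' t) (at t within S)) \<and> continuous_on S g')"

(* D ranges over the finite families of nonoverlapping compact subintervals of {a..b}. *)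
definition abs_continuous_on_interval :: "real \<Rightarrow> real \<Rightarrow> (real \<Rightarrow> 'a::real_normed_vector) \<Rightarrow> bool" where
  "abs_continuous_on_interval a b g \<longleftrightarrow>
     (\<forall>e>0. \<exists>d>0. \<forall>D. D division_of \<Union>D \<and> \<Union>D \<subseteq> {a..b} \<and> (\<Sum>K\<in>D. Sup K - Inf K) < d \<longrightarrow>
        (\<Sum>K\<in>D. norm (g (Sup K) - g (Inf K))) < e)"

definition loc_abs_continuous_from :: "real \<Rightarrow> (real \<Rightarrow> 'a::real_normed_vector) \<Rightarrow> bool" where
  "loc_abs_continuous_from t0 g \<longleftrightarrow> (\<forall>b\<ge>t0. abs_continuous_on_interval t0 b g)"

(* The derivatives of x are Sobolev derivatives on {t0..}: the velocity of x is the locally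
   absolutely continuous function v that agrees with the a.e. derivative of x, and the
   acceleration is the a.e. derivative of v.  Without the absolute continuity of v, the second
   derivative would be only a pointwise a.e. one, and Cantor-type singular perturbations of the
   velocity would be invisible to the equation.  As x is locally absolutely continuous and v is
   continuous, v is in fact the classical derivative of x everywhere, so v t0 is the one-sided
   derivative of x at t0.  Only the values of x on {t0..} matter. *)
definition is_solution ::
    "('a::real_inner \<Rightarrow> ereal) \<Rightarrow> real \<Rightarrow> real \<Rightarrow> real \<Rightarrow> (real \<Rightarrow> real) \<Rightarrow> (real \<Rightarrow> real) \<Rightarrow>
     'a \<Rightarrow> 'a \<Rightarrow> (real \<Rightarrow> 'a) \<Rightarrow> bool" where
  "is_solution f \<alpha> \<beta> t0 \<delta> \<gamma> x0 v0 x \<longleftrightarrow>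
     loc_abs_continuous_from t0 x \<and>
     (\<exists>v. loc_abs_continuous_from t0 v \<and>
        (AE t in lebesgue. t \<ge> t0 \<longrightarrow> (x has_vector_derivative v t) (at t within {t0..})) \<and>
        x t0 = x0 \<and> v t0 = v0 \<and>
        (AE t in lebesgue. t \<ge> t0 \<longrightarrow>
          (\<exists>w g. (v has_vector_derivative w) (at t within {t0..}) \<and>
             ((\<lambda>s. \<delta> s *\<^sub>R gradient (moreau_env f (\<gamma> s)) (x s)) has_vector_derivative g)
               (at t within {t0..}) \<and>
             w + (\<alpha> / t) *\<^sub>R v t + \<beta> *\<^sub>R g
               + ((1 + \<beta> / t) * \<delta> t) *\<^sub>R gradient (moreau_env f (\<gamma> t)) (x t) = 0)))"

end

theory Submission
  imports Defs
begin

text \<open>Put \<open>G(t, x) = \<delta>(t) \<nabla>f\<^bsub>\<gamma>(t)\<^esub>(x)\<close>. Monotonicity of the subdifferential makes \<open>G\<close> Lipschitz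
  in \<open>x\<close> and in \<open>t\<close>, locally in \<open>t\<close>. With \<open>u = x' + \<beta> G(t, x)\<close> the equation becomes the
  system \<open>x' = u - \<beta> G(t, x)\<close>, \<open>u' = - (\<alpha>/t) u + ((\<alpha> \<beta> - \<beta>)/t - 1) G(t, x)\<close>, which Picard iteration
  solves uniquely. Conversely, for a solution of the system, \<open>G(t, x(t))\<close> is locally Lipschitz
  in \<open>t\<close>, hence differentiable almost everywhere because Hilbert spaces have the Radon-Nikodym
  property; and for a solution in the almost-everywhere sense, absolute continuity upgrades
  the derivatives of \<open>x\<close> and \<open>u\<close>, which agree a.e. with continuous functions, to classical ones.\<close>

section \<open>The Moreau envelope and its gradient\<close>

text \<open>Envelope gradients are Lipschitz but in general not differentiable, so d/dt G(t, x(t))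
  cannot be expanded by a chain rule. The shift by \<beta> G absorbs it: only u' = x'' + \<beta>
  d/dt G survives, and the equation prescribes this combination as a continuous function of t.
  Substituting x' = u - \<beta> G into -(\<alpha>/t) x' - (1 + \<beta>/t) G yields the coefficient
  (\<alpha> \<beta> - \<beta>)/t - 1. The Lipschitz bound in x is global in space and uniform on
  compact time intervals, so solutions live on the whole half-line. The obstacle is the way back:
  the equation asks for a strong derivative of G(t, x(t)) at almost every t, in a space that may be
  infinite-dimensional and nonseparable. A Lipschitz curve is nevertheless normed by countably many
  directions, which reduces the question to real functions. There, adding a steep linear function
  makes the map invertible, so that Radon-Nikodym for measures followed by Lebesgue differentiation
  applies. The parallelogram law reassembles the components into a norm limit.\<close>

lemma lsc_fun_sequentially:
  fixes f :: "'a::metric_space \<Rightarrow> ereal"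
  assumes "lsc_fun f" and lim: "X \<longlonglongrightarrow> p" "c \<longlonglongrightarrow> l" and le: "\<And>n. f (X n) \<le> c n"
  shows "f p \<le> l"
proof (rule ccontr)
  assume "\<not> f p \<le> l"
  then obtain r where r: "l < r" "r < f p"
    using dense by (metis not_le)
  then have "r < Liminf (at p) f"
    using \<open>lsc_fun f\<close> by (auto simp: lsc_fun_def intro: less_le_trans)
  then have "eventually (\<lambda>y. r < f y) (at p)"
    by (rule less_LiminfD)
  \<comment> \<open>\<open>Liminf (at p)\<close> ignores the value at \<open>p\<close>;
    \<open>r < f p\<close> supplies it, so the sequence is allowed to hit \<open>p\<close>.\<close>
  then have "eventually (\<lambda>y. r < f y) (nhds p)"
    unfolding eventually_at_filter by (rule eventually_mono) (use r in auto)
  then have "eventually (\<lambda>n. r < f (X n)) sequentially"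
    using lim(1) unfolding filterlim_iff by blast
  moreover have "eventually (\<lambda>n. c n < r) sequentially"
    using lim(2) r(1) by (rule order_tendstoD)
  ultimately have "eventually (\<lambda>n. r < f (X n) \<and> c n < r) sequentially"
    by (rule eventually_conj)
  then obtain n where "r < f (X n)" "c n < r"
    by (auto simp: eventually_sequentially)
  with le[of n] show False by (auto dest: less_le_trans less_trans)
qed

section \<open>Subgradients and their resolvents\<close>

definition subgrad :: "('a::real_inner \<Rightarrow> ereal) \<Rightarrow> 'a \<Rightarrow> 'a \<Rightarrow> bool" where
  "subgrad f p \<xi> \<longleftrightarrow> (\<exists>r. f p = ereal r \<and> (\<forall>y. ereal (r + inner \<xi> (y - p)) \<le> f y))"

lemma subgrad_monotone:
  assumes "subgrad f p \<xi>" "subgrad f q \<eta>"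
  shows "0 \<le> inner (\<xi> - \<eta>) (p - q)"
proof -
  obtain r s where *: "f p = ereal r" "\<And>y. ereal (r + inner \<xi> (y - p)) \<le> f y"
    "f q = ereal s" "\<And>y. ereal (s + inner \<eta> (y - q)) \<le> f y"
    using assms unfolding subgrad_def by blast
  show ?thesis
    using *(2)[of q] *(4)[of p] unfolding *(1) *(3)
    by (simp add: inner_diff_left inner_diff_right)
qed

text \<open>Lets a step length u tend to 0 in a first-order optimality argument; \<open>b\<close>
  plays the part of the quadratic remainder.\<close>

lemma nonpos_if_le_small_multiples:
  fixes a b :: real
  assumes "\<And>u. 0 < u \<Longrightarrow> u < 1 \<Longrightarrow> a \<le> u * b"
  shows "a \<le> 0"
proof (rule ccontr)
  assume "\<not> a \<le> 0"
  then have a: "a > 0" by simp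
  define u where "u = min (1/2) (a / (2 * (\<bar>b\<bar> + 1)))"
  have u: "0 < u" "u < 1" using a by (auto simp: u_def)
  have "u * b \<le> u * (\<bar>b\<bar> + 1)" using u by (intro mult_left_mono) auto
  also have "\<dots> \<le> a / (2 * (\<bar>b\<bar> + 1)) * (\<bar>b\<bar> + 1)"
    by (intro mult_right_mono) (auto simp: u_def)
  also have "\<dots> = a / 2" by (simp add: field_simps)
  finally show False using assms[OF u] a by simp
qed

text \<open>Direct method for the strongly convex \<phi>: the parallelogram law at midpoints forces
  a minimising sequence to be Cauchy, lower semicontinuity makes its limit \<open>p\<close> a
  minimiser, and comparing \<open>p\<close> with points on the segment towards \<open>y\<close>
  gives the optimality condition. The minimiser \<open>z\<close> of \<open>f\<close> bounds \<phi>
  below and makes its infimum finite.\<close>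

lemma subgrad_resolvent_exists:
  fixes f :: "'a::{real_inner, complete_space} \<Rightarrow> ereal"
  assumes f: "proper_fun f" "convex_fun f" "lsc_fun f" and z: "z \<in> argmin f" and \<mu>: "\<mu> > 0"
  shows "\<exists>\<xi>. subgrad f (x - \<mu> *\<^sub>R \<xi>) \<xi>"
proof -
  define \<phi> where "\<phi> y = f y + ereal ((norm (x - y))\<^sup>2 / (2 * \<mu>))" for y
  have min: "f z \<le> f y" for y
    using z by (auto simp: argmin_def is_arg_min_def not_less)
  have nm: "f y \<noteq> -\<infinity>" for y using f(1) by (auto simp: proper_fun_def)
  have "f z \<noteq> \<infinity>"
    using f(1) min by (force simp: proper_fun_def)
  then obtain fz where fz: "f z = ereal fz"
    using nm[of z] by (cases "f z") auto
  define M where "M = (INF y. \<phi> y)"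
  have "ereal fz \<le> M"
    unfolding M_def
  proof (rule INF_greatest)
    fix y
    have "ereal fz + ereal 0 \<le> f y + ereal ((norm (x - y))\<^sup>2 / (2 * \<mu>))"
      using min[of y] fz \<mu> by (intro add_mono) auto
    then show "ereal fz \<le> \<phi> y" by (simp add: \<phi>_def)
  qed
  moreover have "M \<le> \<phi> z" unfolding M_def by (rule INF_lower) simp
  ultimately obtain m where m: "M = ereal m"
    by (cases M) (auto simp: \<phi>_def fz)
  have mle: "ereal m \<le> \<phi> y" for y
    unfolding m[symmetric] M_def by (rule INF_lower) simp
  have "\<exists>y. \<phi> y < ereal (m + 1 / Suc n)" for n
  proof -
    have "M < ereal (m + 1 / Suc n)" by (simp add: m)
    then show ?thesis unfolding M_def by (auto simp: INF_less_iff)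
  qed
  then obtain Y where Y: "\<And>n. \<phi> (Y n) < ereal (m + 1 / Suc n)" by metis
  have "\<exists>r. f (Y n) = ereal r" for n
    using Y[of n] nm[of "Y n"] by (cases "f (Y n)") (auto simp: \<phi>_def)
  then obtain r where r: "\<And>n. f (Y n) = ereal (r n)" by metis
  have Yr: "r n + (norm (x - Y n))\<^sup>2 / (2 * \<mu>) < m + 1 / Suc n" for n
    using Y[of n] by (simp add: \<phi>_def r)
  have par: "(norm (Y i - Y j))\<^sup>2 \<le> 4 * \<mu> * (1 / Suc i + 1 / Suc j)" for i j
  proof -
    \<comment> \<open>Midpoint, with its first weight spelled \<open>1 - 1/2\<close> so that
      \<open>convex_fun\<close> applies verbatim.\<close>
    define c where "c = (1 - 1/2) *\<^sub>R Y i + (1/2::real) *\<^sub>R Y j"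
    have "f c \<le> ereal (1 - 1/2) * f (Y i) + ereal (1/2) * f (Y j)"
      using f(2) unfolding convex_fun_def c_def
      by (elim allE ballE[where x="1/2"]) auto
    then have fc: "f c \<le> ereal ((r i + r j) / 2)"
      by (simp add: r add_divide_distrib)
    have "ereal m \<le> ereal ((r i + r j) / 2) + ereal ((norm (x - c))\<^sup>2 / (2 * \<mu>))"
      using mle[of c] fc unfolding \<phi>_def by (rule order_trans[OF _ add_right_mono])
    then have 1: "m \<le> (r i + r j) / 2 + (norm (x - c))\<^sup>2 / (2 * \<mu>)" by simp
    \<comment> \<open>Parallelogram law: the penalty at the midpoint drops by a multiple of the
      squared distance of Y i and Y j, yet \<phi> cannot fall below \<open>m\<close> there.\<close>
    have 2: "(norm (x - c))\<^sup>2 = ((norm (x - Y i))\<^sup>2 + (norm (x - Y j))\<^sup>2) / 2 - (norm (Y i - Y j))\<^sup>2 / 4"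
      unfolding c_def power2_norm_eq_inner
      by (simp add: inner_diff_left inner_diff_right inner_add_left inner_add_right inner_commute field_simps)
    have "(norm (x - c))\<^sup>2 / (2 * \<mu>) = ((norm (x - Y i))\<^sup>2 / (2 * \<mu>) + (norm (x - Y j))\<^sup>2 / (2 * \<mu>)) / 2
         - (norm (Y i - Y j))\<^sup>2 / (8 * \<mu>)"
      unfolding 2 using \<mu> by (simp add: field_simps)
    with 1 Yr[of i] Yr[of j] have "(norm (Y i - Y j))\<^sup>2 / (8 * \<mu>) \<le> (1 / Suc i + 1 / Suc j) / 2"
      by argo
    then have "8 * \<mu> * ((norm (Y i - Y j))\<^sup>2 / (8 * \<mu>)) \<le> 8 * \<mu> * ((1 / Suc i + 1 / Suc j) / 2)"
      using \<mu> by (intro mult_left_mono) auto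
    then show ?thesis using \<mu> by simp
  qed
  have "Cauchy Y"
  proof (rule metric_CauchyI)
    fix e :: real assume "e > 0"
    then obtain N where N: "inverse (real (Suc N)) < e\<^sup>2 / (8 * \<mu>)"
      using reals_Archimedean[of "e\<^sup>2 / (8 * \<mu>)"] \<mu> by auto
    show "\<exists>N. \<forall>i\<ge>N. \<forall>j\<ge>N. dist (Y i) (Y j) < e"
    proof (intro exI allI impI)
      fix i j assume ij: "N \<le> i" "N \<le> j"
      have "1 / real (Suc i) \<le> inverse (real (Suc N))" "1 / real (Suc j) \<le> inverse (real (Suc N))"
        using ij by (auto simp: field_simps)
      moreover have "e\<^sup>2 / (4 * \<mu>) = e\<^sup>2 / (8 * \<mu>) + e\<^sup>2 / (8 * \<mu>)" by simp
      ultimately have "1 / Suc i + 1 / Suc j < e\<^sup>2 / (4 * \<mu>)" using N by linarith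
      then have "4 * \<mu> * (1 / Suc i + 1 / Suc j) < e\<^sup>2"
        using \<mu> by (simp add: field_simps)
      with par[of i j] have "(norm (Y i - Y j))\<^sup>2 < e\<^sup>2" by linarith
      then show "dist (Y i) (Y j) < e"
        using \<open>e > 0\<close> by (simp add: dist_norm power_less_imp_less_base)
    qed
  qed
  then obtain p where p: "Y \<longlonglongrightarrow> p" by (auto simp: Cauchy_convergent_iff convergent_def)
  \<comment> \<open>\<open>m + 0\<close> keeps the shape of the limit of m + 1 / Suc n, so that
    \<open>tendsto_intros\<close> matches.\<close>
  have "f p \<le> ereal (m + 0 - (norm (x - p))\<^sup>2 / (2 * \<mu>))"
  proof (rule lsc_fun_sequentially[OF f(3) p])
    show "(\<lambda>n. ereal (m + 1 / Suc n - (norm (x - Y n))\<^sup>2 / (2 * \<mu>)))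
        \<longlonglongrightarrow> ereal (m + 0 - (norm (x - p))\<^sup>2 / (2 * \<mu>))"
      unfolding lim_ereal using \<mu> p LIMSEQ_inverse_real_of_nat
      by (intro tendsto_intros) (auto simp: inverse_eq_divide)
    show "f (Y n) \<le> ereal (m + 1 / Suc n - (norm (x - Y n))\<^sup>2 / (2 * \<mu>))" for n
      using Yr[of n] by (simp add: r)
  qed
  then obtain rp where rp: "f p = ereal rp" and rple: "rp + (norm (x - p))\<^sup>2 / (2 * \<mu>) \<le> m"
    using nm[of p] by (cases "f p") auto
  \<comment> \<open>Minus the gradient of the quadratic penalty at \<open>p\<close>.\<close>
  define \<xi> where "\<xi> = (1/\<mu>) *\<^sub>R (x - p)"
  have "subgrad f p \<xi>"
    unfolding subgrad_def
  proof (intro exI conjI allI)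
    show "f p = ereal rp" by fact
    fix y
    show "ereal (rp + inner \<xi> (y - p)) \<le> f y"
    proof (cases "f y")
      case (real ry)
      have "rp + inner \<xi> (y - p) - ry \<le> 0"
      proof (rule nonpos_if_le_small_multiples)
        fix u :: real assume u: "0 < u" "u < 1"
        \<comment> \<open>A move by the fraction u from p towards y: the penalty deviates from its
          linear part by a term of order u^2 only, so dividing by u and letting u tend to 0 leaves
          the subgradient inequality.\<close>
        define c where "c = (1 - u) *\<^sub>R p + u *\<^sub>R y"
        have "f c \<le> ereal (1 - u) * f p + ereal u * f y"
          using f(2) u unfolding convex_fun_def c_def by auto
        then have fc: "f c \<le> ereal ((1 - u) * rp + u * ry)"
          by (simp add: rp real)
        have "ereal m \<le> ereal ((1 - u) * rp + u * ry) + ereal ((norm (x - c))\<^sup>2 / (2 * \<mu>))"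
          using mle[of c] fc unfolding \<phi>_def by (rule order_trans[OF _ add_right_mono])
        then have 1: "m \<le> (1 - u) * rp + u * ry + (norm (x - c))\<^sup>2 / (2 * \<mu>)" by simp
        have xc: "x - c = (x - p) - u *\<^sub>R (y - p)" by (simp add: c_def algebra_simps)
        have "(norm (x - c))\<^sup>2 = (norm (x - p))\<^sup>2 - 2 * u * inner (x - p) (y - p) + u\<^sup>2 * (norm (y - p))\<^sup>2"
          unfolding power2_norm_eq_inner xc
          by (simp add: inner_diff_left inner_diff_right inner_commute algebra_simps power2_eq_square)
        moreover have "inner \<xi> (y - p) = inner (x - p) (y - p) / \<mu>"
          by (simp add: \<xi>_def)
        ultimately have "(norm (x - c))\<^sup>2 / (2 * \<mu>) = (norm (x - p))\<^sup>2 / (2 * \<mu>) - u * inner \<xi> (y - p)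
             + u * (u * ((norm (y - p))\<^sup>2 / (2 * \<mu>)))"
          by (simp add: diff_divide_distrib add_divide_distrib power2_eq_square mult.assoc)
        with 1 rple have "u * (rp + inner \<xi> (y - p) - ry) \<le> u * (u * ((norm (y - p))\<^sup>2 / (2 * \<mu>)))"
          by (simp add: algebra_simps)
        then show "rp + inner \<xi> (y - p) - ry \<le> u * ((norm (y - p))\<^sup>2 / (2 * \<mu>))"
          using u by (simp only: mult_le_cancel_left_pos)
      qed
      then show ?thesis by (simp add: real)
    qed (use nm[of y] in auto)
  qed
  moreover have "x - \<mu> *\<^sub>R \<xi> = p" using \<mu> by (simp add: \<xi>_def)
  ultimately show ?thesis by metis
qed

text \<open>The minimiser in the definition of the Moreau envelope is \<open>x - \<mu> *\<^sub>R yosida f \<mu> x\<close>.\<close>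

definition yosida :: "('a::real_inner \<Rightarrow> ereal) \<Rightarrow> real \<Rightarrow> 'a \<Rightarrow> 'a" where
  "yosida f \<mu> x = (SOME \<xi>. subgrad f (x - \<mu> *\<^sub>R \<xi>) \<xi>)"

text \<open>Monotonicity is applied at the two base points, whose difference is (x - y) - \<mu> (A -
  B) + (\<nu> - \<mu>) B. Letting point and parameter vary together makes one inequality serve for
  the Lipschitz bound in the point, the dependence on the parameter, and the linear growth.\<close>

lemma subgrad_resolvent_diff:
  assumes "subgrad f (x - \<mu> *\<^sub>R A) A" "subgrad f (y - \<nu> *\<^sub>R B) B" "\<mu> > 0"
  shows "\<mu> * norm (A - B) \<le> norm (x - y) + \<bar>\<mu> - \<nu>\<bar> * norm B"
proof (cases "A = B")
  case False
  have "0 \<le> inner (A - B) ((x - y) - \<mu> *\<^sub>R (A - B) + (\<nu> - \<mu>) *\<^sub>R B)"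
    using subgrad_monotone[OF assms(1,2)] by (simp add: algebra_simps)
  then have "\<mu> * (norm (A - B))\<^sup>2 \<le> inner (A - B) ((x - y) + (\<nu> - \<mu>) *\<^sub>R B)"
    unfolding power2_norm_eq_inner by (simp add: inner_add_right inner_diff_right algebra_simps)
  also have "\<dots> \<le> norm (A - B) * norm ((x - y) + (\<nu> - \<mu>) *\<^sub>R B)"
    by (rule norm_cauchy_schwarz)
  also have "\<dots> \<le> norm (A - B) * (norm (x - y) + \<bar>\<mu> - \<nu>\<bar> * norm B)"
    by (intro mult_left_mono norm_triangle_le) (auto simp: abs_minus_commute)
  finally have "norm (A - B) * (\<mu> * norm (A - B)) \<le> norm (A - B) * (norm (x - y) + \<bar>\<mu> - \<nu>\<bar> * norm B)"
    by (simp add: power2_eq_square mult_ac)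
  then show ?thesis using False by (simp add: mult_le_cancel_left_pos)
qed simp

section \<open>Values and differentiability of the envelope\<close>

text \<open>The infimum is attained at p = x - \<mu> A: completing the square, f y plus the penalty
  exceeds the claimed value by at least (norm (p - y))^2 / (2 \<mu>).\<close>

lemma moreau_env_subgrad:
  assumes "subgrad f (x - \<mu> *\<^sub>R A) A" "\<mu> > 0"
  shows "moreau_env f \<mu> x = real_of_ereal (f (x - \<mu> *\<^sub>R A)) + \<mu> / 2 * (norm A)\<^sup>2"
proof -
  define p where "p = x - \<mu> *\<^sub>R A"
  obtain r where r: "f p = ereal r" "\<And>y. ereal (r + inner A (y - p)) \<le> f y"
    using assms(1) by (auto simp: subgrad_def p_def)
  have "(INF y. f y + ereal (1 / (2 * \<mu>) * (norm (x - y))\<^sup>2)) = ereal (r + \<mu> / 2 * (norm A)\<^sup>2)"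
  proof (rule antisym)
    have "1 / (2 * \<mu>) * (norm (x - p))\<^sup>2 = \<mu> / 2 * (norm A)\<^sup>2"
      using assms(2) by (simp add: p_def power2_eq_square)
    then have "f p + ereal (1 / (2 * \<mu>) * (norm (x - p))\<^sup>2) = ereal (r + \<mu> / 2 * (norm A)\<^sup>2)"
      using r(1) by simp
    then show "(INF y. f y + ereal (1 / (2 * \<mu>) * (norm (x - y))\<^sup>2)) \<le> ereal (r + \<mu> / 2 * (norm A)\<^sup>2)"
      using INF_lower[of p UNIV "\<lambda>y. f y + ereal (1 / (2 * \<mu>) * (norm (x - y))\<^sup>2)"] by simp
    show "ereal (r + \<mu> / 2 * (norm A)\<^sup>2) \<le> (INF y. f y + ereal (1 / (2 * \<mu>) * (norm (x - y))\<^sup>2))"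
    proof (rule INF_greatest)
      fix y
      have "x - y = (p - y) + \<mu> *\<^sub>R A" by (simp add: p_def)
      then have "(norm (x - y))\<^sup>2 = (norm (p - y))\<^sup>2 + 2 * \<mu> * inner A (p - y) + \<mu>\<^sup>2 * (norm A)\<^sup>2"
        unfolding power2_norm_eq_inner
        by (simp add: inner_add_left inner_add_right inner_commute power2_eq_square algebra_simps)
      then have "1 / (2 * \<mu>) * (norm (x - y))\<^sup>2 = (norm (p - y))\<^sup>2 / (2 * \<mu>) - inner A (y - p) + \<mu> / 2 * (norm A)\<^sup>2"
        using assms(2) by (simp add: field_simps power2_eq_square inner_diff_right)
      moreover have "0 \<le> (norm (p - y))\<^sup>2 / (2 * \<mu>)" using assms(2) by simp
      ultimately have "ereal (r + \<mu> / 2 * (norm A)\<^sup>2) \<le> ereal (r + inner A (y - p)) + ereal (1 / (2 * \<mu>) * (norm (x - y))\<^sup>2)"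
        by (simp add: algebra_simps)
      also have "\<dots> \<le> f y + ereal (1 / (2 * \<mu>) * (norm (x - y))\<^sup>2)"
        by (intro add_right_mono r)
      finally show "ereal (r + \<mu> / 2 * (norm A)\<^sup>2) \<le> f y + ereal (1 / (2 * \<mu>) * (norm (x - y))\<^sup>2)" .
    qed
  qed
  then show ?thesis using r(1) by (simp add: moreau_env_def flip: p_def)
qed

text \<open>\<open>A\<close> is a subgradient of the envelope at \<open>x\<close>: the subgradient
  inequality of f between the two proximal points even leaves a surplus of \<mu>/2 times the squared
  norm of A - B.\<close>

lemma moreau_env_ge:
  assumes A: "subgrad f (x - \<mu> *\<^sub>R A) A" and B: "subgrad f (y - \<mu> *\<^sub>R B) B" and \<mu>: "\<mu> > 0"
  shows "inner A (y - x) \<le> moreau_env f \<mu> y - moreau_env f \<mu> x"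
proof -
  define p q where "p = x - \<mu> *\<^sub>R A" and "q = y - \<mu> *\<^sub>R B"
  obtain r where r: "f p = ereal r" "\<And>y. ereal (r + inner A (y - p)) \<le> f y"
    using A by (auto simp: subgrad_def p_def)
  obtain s where s: "f q = ereal s"
    using B by (auto simp: subgrad_def q_def)
  have 1: "r + inner A (q - p) \<le> s" using r(2)[of q] by (simp add: s)
  have 2: "inner A (q - p) = inner A (y - x) + \<mu> * inner A A - \<mu> * inner A B"
    by (simp add: p_def q_def inner_diff_right inner_add_right algebra_simps)
  have "0 \<le> \<mu> / 2 * inner (A - B) (A - B)" using \<mu> by simp
  also have "\<dots> = \<mu> / 2 * inner A A - \<mu> * inner A B + \<mu> / 2 * inner B B"
    by (simp add: inner_diff_left inner_diff_right inner_commute algebra_simps)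
  finally have 3: "0 \<le> \<mu> / 2 * inner A A - \<mu> * inner A B + \<mu> / 2 * inner B B" .
  have "moreau_env f \<mu> y = s + \<mu> / 2 * inner B B" "moreau_env f \<mu> x = r + \<mu> / 2 * inner A A"
    using moreau_env_subgrad[OF A \<mu>] moreau_env_subgrad[OF B \<mu>] r(1) s
    by (simp_all add: power2_norm_eq_inner flip: p_def q_def)
  with 1 2 3 show ?thesis by argo
qed

context
  fixes f :: "'a::{real_inner, complete_space} \<Rightarrow> ereal" and z :: 'a
  assumes f: "proper_fun f" "convex_fun f" "lsc_fun f" and z: "z \<in> argmin f"
begin

lemma subgrad_yosida:
  assumes "\<mu> > 0"
  shows "subgrad f (x - \<mu> *\<^sub>R yosida f \<mu> x) (yosida f \<mu> x)"
  unfolding yosida_def using subgrad_resolvent_exists[OF f z assms] by (rule someI_ex)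

lemma yosida_diff:
  assumes "\<mu> > 0" "\<nu> > 0"
  shows "\<mu> * norm (yosida f \<mu> x - yosida f \<nu> y) \<le> norm (x - y) + \<bar>\<mu> - \<nu>\<bar> * norm (yosida f \<nu> y)"
  by (rule subgrad_resolvent_diff[OF subgrad_yosida subgrad_yosida]) (use assms in auto)

text \<open>At the minimiser \<open>z\<close> the subgradient 0 is available, so \<open>z\<close> is
  its own proximal point and can be compared with x. The resulting linear growth is what later
  controls the variation in time.\<close>

lemma norm_yosida_le:
  assumes "\<mu> > 0"
  shows "\<mu> * norm (yosida f \<mu> x) \<le> norm (x - z)"
proof -
  have min: "f z \<le> f y" for y
    using z by (auto simp: argmin_def is_arg_min_def not_less)
  then have "f z \<noteq> \<infinity>" "f z \<noteq> -\<infinity>"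
    using f(1) by (force simp: proper_fun_def)+
  then obtain r where "f z = ereal r" by (cases "f z") auto
  then have "subgrad f (z - \<mu> *\<^sub>R 0) 0"
    using min by (auto simp: subgrad_def)
  from subgrad_resolvent_diff[OF subgrad_yosida[OF assms] this assms]
  show ?thesis by simp
qed

text \<open>The subgradient inequality of the envelope, used in both directions, traps the
  first-order remainder between 0 and the inner product of \<open>?B - ?A\<close> with y - x. The
  latter is at most (norm (y - x))^2 / \<mu>, since \<open>yosida\<close> is 1/\<mu>-Lipschitz in
  the point.\<close>

lemma moreau_env_GDERIV:
  assumes \<mu>: "\<mu> > 0"
  shows "GDERIV (moreau_env f \<mu>) x :> yosida f \<mu> x"
  unfolding gderiv_def
proof (rule has_derivativeI_sandwich[where e=1 and H="\<lambda>y. norm (y - x) / \<mu>" and s=UNIV])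
  show "bounded_linear (\<lambda>h. inner h (yosida f \<mu> x))" by (rule bounded_linear_inner_left)
  show "(\<lambda>y. norm (y - x) / \<mu>) \<midarrow>x\<rightarrow> 0"
    by (rule tendsto_eq_intros refl | use \<mu> in simp)+
  fix y assume "y \<noteq> x"
  let ?A = "yosida f \<mu> x" and ?B = "yosida f \<mu> y"
  note AB = subgrad_yosida[OF \<mu>, of x] subgrad_yosida[OF \<mu>, of y]
  let ?d = "moreau_env f \<mu> y - moreau_env f \<mu> x - inner ?A (y - x)"
  have "0 \<le> ?d" using moreau_env_ge[OF AB \<mu>] by simp
  moreover have "?d \<le> inner (?B - ?A) (y - x)"
    using moreau_env_ge[OF AB(2,1) \<mu>] by (simp add: inner_diff_left inner_diff_right)
  moreover have "inner (?B - ?A) (y - x) \<le> norm (?B - ?A) * norm (y - x)"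
    by (rule norm_cauchy_schwarz)
  moreover have "\<dots> \<le> (norm (y - x) / \<mu>) * norm (y - x)"
    using yosida_diff[OF \<mu> \<mu>, of y x] \<mu> by (intro mult_right_mono) (auto simp: field_simps)
  ultimately have "norm ?d \<le> (norm (y - x) / \<mu>) * norm (y - x)" by simp
  then show "norm (moreau_env f \<mu> y - moreau_env f \<mu> x - inner (y - x) ?A) / norm (y - x) \<le> norm (y - x) / \<mu>"
    using \<open>y \<noteq> x\<close> by (simp add: pos_divide_le_eq inner_commute)
qed simp

lemma gradient_moreau_env:
  assumes "\<mu> > 0"
  shows "gradient (moreau_env f \<mu>) x = yosida f \<mu> x"
  unfolding gradient_def
proof (rule the_equality)
  show "GDERIV (moreau_env f \<mu>) x :> yosida f \<mu> x" by (rule moreau_env_GDERIV[OF assms])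
  fix d assume "GDERIV (moreau_env f \<mu>) x :> d"
  then have "(\<lambda>h. inner h d) = (\<lambda>h. inner h (yosida f \<mu> x))"
    using moreau_env_GDERIV[OF assms] unfolding gderiv_def by (rule has_derivative_unique)
  \<comment> \<open>Two vectors representing the same functional are tested against their own
    difference.\<close>
  then have "inner (d - yosida f \<mu> x) d = inner (d - yosida f \<mu> x) (yosida f \<mu> x)"
    by (rule fun_cong)
  then have "inner (d - yosida f \<mu> x) (d - yosida f \<mu> x) = 0"
    by (simp add: inner_diff_right)
  then show "d = yosida f \<mu> x" by simp
qed

end

section \<open>Absolutely continuous functions\<close>

text \<open>The null set is covered by an open U whose measure is below the \<open>d\<close> that
  absolute continuity assigns to \<open>e\<close>; intervals inside U do not overlap, so their total
  length stays below \<open>d\<close>.\<close>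

lemma abs_continuous_negligible_sum_small:
  assumes F: "abs_continuous_on_interval a b F" and N: "negligible N" and e: "e > 0"
  obtains U where "open U" "N \<subseteq> U"
    "\<And>p. p tagged_partial_division_of {a..b} \<Longrightarrow> (\<And>x K. (x, K) \<in> p \<Longrightarrow> K \<subseteq> U) \<Longrightarrow>
       (\<Sum>(x, K)\<in>p. norm (F (Sup K) - F (Inf K))) < e"
proof -
  obtain d where d: "d > 0" and dF: "\<And>D. D division_of \<Union>D \<Longrightarrow> \<Union>D \<subseteq> {a..b} \<Longrightarrow> (\<Sum>K\<in>D. Sup K - Inf K) < d \<Longrightarrow>
        (\<Sum>K\<in>D. norm (F (Sup K) - F (Inf K))) < e"
    using F e unfolding abs_continuous_on_interval_def by meson
  obtain U where U: "open U" "N \<subseteq> U" "(U - N) \<in> lmeasurable" "emeasure lebesgue (U - N) < ennreal d"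
    using sets_lebesgue_outer_open[OF negligible_imp_sets[OF N] d] by metis
  have "U = (U - N) \<union> N" using U(2) by auto
  moreover have "N \<in> lmeasurable" using N by (rule negligible_imp_measurable)
  ultimately have Um: "U \<in> lmeasurable" using U(3) by (metis fmeasurable.Un)
  have "measure lebesgue U = measure lebesgue (U - N)"
    using Um N by (simp add: measure_Diff_null_set negligible_iff_null_sets)
  also have "\<dots> < d"
    using U(3,4) d by (simp add: emeasure_eq_measure2 ennreal_less_iff)
  finally have Ud: "measure lebesgue U < d" .
  show thesis
  proof
    fix p assume p: "p tagged_partial_division_of {a..b}" and pU: "\<And>x K. (x, K) \<in> p \<Longrightarrow> K \<subseteq> U"
    let ?D = "snd ` p"
    have D: "?D division_of \<Union>?D" using p by (rule partial_division_of_tagged_division)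
    have box: "\<exists>u v. K = {u..v} \<and> u \<le> v" if "K \<in> ?D" for K
      using division_ofD(3,4)[OF D that] by fastforce
    have len: "Sup K - Inf K = measure lebesgue K" if K: "K \<in> ?D" for K
      using box[OF K] by auto
    have "(\<Sum>K\<in>?D. Sup K - Inf K) = (\<Sum>K\<in>?D. measure lebesgue K)"
      by (rule sum.cong) (auto simp only: len)
    also have "\<dots> = measure lebesgue (\<Union>?D)"
      by (rule content_division[OF D])
    also have "\<dots> \<le> measure lebesgue U"
    proof (rule measure_mono_fmeasurable[OF _ _ Um])
      show "\<Union>?D \<subseteq> U" using pU by fastforce
      show "\<Union>?D \<in> sets lebesgue"
        using division_ofD(1)[OF D] box by (intro sets.finite_Union) fastforce+
    qed
    finally have "(\<Sum>K\<in>?D. Sup K - Inf K) < d" using Ud by linarith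
    moreover have "\<Union>?D \<subseteq> {a..b}"
      using tagged_partial_division_ofD(3)[OF p] by fastforce
    ultimately have "(\<Sum>K\<in>?D. norm (F (Sup K) - F (Inf K))) < e"
      using dF[OF D] by blast
    moreover have "(\<Sum>(x, K)\<in>p. norm (F (Sup K) - F (Inf K))) = (\<Sum>K\<in>?D. norm (F (Sup K) - F (Inf K)))"
    proof -
      \<comment> \<open>Passing from tagged pairs to intervals requires the value 0 on every box
        with empty interior. This includes the empty box, where \<open>Sup\<close> and
        \<open>Inf\<close> carry no meaning, hence the case distinction.\<close>
      define G where "G K = (if K = {} then 0 else norm (F (Sup K) - F (Inf K)))" for K
      have "(\<Sum>(x, K)\<in>p. G K) = (\<Sum>K\<in>?D. G K)"
      proof (rule sum.over_tagged_division_lemma[OF tagged_partial_division_of_Union_self[OF p]])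
        fix u v :: real
        assume "box u v = {}"
        then have "v \<le> u" by simp
        then show "G (cbox u v) = 0"
          by (cases "u = v") (auto simp: G_def)
      qed
      moreover have "G K = norm (F (Sup K) - F (Inf K))" if "K \<in> ?D" for K
        using box[OF that] by (auto simp: G_def)
      ultimately show ?thesis by (simp add: split_def)
    qed
    ultimately show "(\<Sum>(x, K)\<in>p. norm (F (Sup K) - F (Inf K))) < e" by simp
  qed (use U in auto)
qed

text \<open>Gauges make the null set of exceptional points harmless: tags in it are confined to an
  open set of small measure, over which absolute continuity controls the increments.\<close>

lemma fundamental_theorem_of_calculus_abs_continuous:
  fixes F :: "real \<Rightarrow> 'a::real_normed_vector"
  assumes F: "abs_continuous_on_interval a b F" and ab: "a \<le> b" and N: "negligible N"
    and der: "\<And>t. t \<in> {a..b} - N \<Longrightarrow> (F has_vector_derivative h t) (at t within {a..b})"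
  shows "(h has_integral F b - F a) {a..b}"
proof -
  \<comment> \<open>Zero on N: a tag in N contributes nothing to the Riemann sum, and its whole
    error is the increment of F.\<close>
  define h0 where "h0 t = (if t \<in> N then 0 else h t)" for t
  have "(h0 has_integral F b - F a) {a..b}"
    unfolding has_integral_real
  proof (intro allI impI)
    fix e :: real assume e: "e > 0"
    \<comment> \<open>\<open>b - a + 1\<close> in place of \<open>b - a\<close> keeps the quotient
      meaningful when a = b.\<close>
    define e1 where "e1 = e / (2 * (b - a + 1))"
    have e1: "e1 > 0" "e1 * (b - a) \<le> e / 2"
    proof -
      show "e1 > 0" using e ab by (simp add: e1_def)
      then have "e1 * (b - a) \<le> e1 * (b - a + 1)" by simp
      also have "\<dots> = e / 2" using ab by (simp add: e1_def field_simps)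
      finally show "e1 * (b - a) \<le> e / 2" .
    qed
    obtain U where U: "open U" "N \<subseteq> U"
      "\<And>p. p tagged_partial_division_of {a..b} \<Longrightarrow> (\<And>x K. (x, K) \<in> p \<Longrightarrow> K \<subseteq> U) \<Longrightarrow>
       (\<Sum>(x, K)\<in>p. norm (F (Sup K) - F (Inf K))) < e / 2"
      using abs_continuous_negligible_sum_small[OF F N half_gt_zero[OF e]] by blast
    \<comment> \<open>Two-part gauge: at tags in N the ball stays inside \<open>U\<close>; at other
      tags of the interval it is a radius on which the linear approximation by \<open>h x\<close>
      has relative error at most \<open>e1\<close>.\<close>
    have "\<exists>d>0. (x \<in> N \<longrightarrow> ball x d \<subseteq> U) \<and> (x \<in> {a..b} - N \<longrightarrow>
      (\<forall>y\<in>{a..b}. norm (y - x) < d \<longrightarrow> norm (F y - F x - (y - x) *\<^sub>R h x) \<le> e1 * norm (y - x)))" for x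
    proof (cases "x \<in> N")
      case True
      then show ?thesis using U(1,2) by (auto simp: open_contains_ball)
    next
      case False
      then show ?thesis
        using der[unfolded has_vector_derivative_def has_derivative_within_alt, of x] e1(1)
        by (cases "x \<in> {a..b}") (auto intro: exI[of _ "1::real"])
    qed
    then have "\<exists>d. \<forall>x. d x > 0 \<and> (x \<in> N \<longrightarrow> ball x (d x) \<subseteq> U) \<and> (x \<in> {a..b} - N \<longrightarrow>
      (\<forall>y\<in>{a..b}. norm (y - x) < d x \<longrightarrow> norm (F y - F x - (y - x) *\<^sub>R h x) \<le> e1 * norm (y - x)))"
      by (intro choice) blast
    then obtain d where d: "\<And>x. d x > 0" "\<And>x. x \<in> N \<Longrightarrow> ball x (d x) \<subseteq> U"
      and dd: "\<And>x y. x \<in> {a..b} \<Longrightarrow> x \<notin> N \<Longrightarrow> y \<in> {a..b} \<Longrightarrow> norm (y - x) < d x \<Longrightarrow>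
        norm (F y - F x - (y - x) *\<^sub>R h x) \<le> e1 * norm (y - x)"
      by blast
    show "\<exists>\<gamma>. gauge \<gamma> \<and> (\<forall>\<D>. \<D> tagged_division_of {a..b} \<and> \<gamma> fine \<D> \<longrightarrow>
        norm ((\<Sum>(x, k)\<in>\<D>. measure lborel k *\<^sub>R h0 x) - (F b - F a)) < e)"
    proof (rule exI, safe)
      show "gauge (\<lambda>x. ball x (d x))"
        using d(1) gauge_ball_dependent by blast
    next
      fix p
      assume p: "p tagged_division_of {a..b}" and fine: "(\<lambda>x. ball x (d x)) fine p"
      note fin = tagged_division_ofD(1)[OF p]
      define q where "q = {(x, K) \<in> p. x \<in> N}"
      have qp: "q \<subseteq> p" by (auto simp: q_def)
      have qsum: "(\<Sum>(x, K)\<in>q. norm (F (Sup K) - F (Inf K))) < e / 2"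
      proof (rule U(3))
        show "q tagged_partial_division_of {a..b}"
          using p qp by (meson tagged_division_of_def tagged_partial_division_subset)
        show "K \<subseteq> U" if "(x, K) \<in> q" for x K
          using that fine d(2)[of x] by (auto simp: q_def dest: fineD)
      qed
      have ba: "b - a = (\<Sum>(x,K)\<in>p. Sup K - Inf K)" "F b - F a = (\<Sum>(x,K)\<in>p. F (Sup K) - F (Inf K))"
        using additive_tagged_division_1[where f= "\<lambda>x. x", OF ab p]
          additive_tagged_division_1[where f=F, OF ab p] by auto
      have "norm (\<Sum>z\<in>p. case z of (x, K) \<Rightarrow> measure lborel K *\<^sub>R h0 x - (F (Sup K) - F (Inf K)))
          \<le> (\<Sum>z\<in>p. case z of (x, K) \<Rightarrow> e1 * (Sup K - Inf K) + (if x \<in> N then norm (F (Sup K) - F (Inf K)) else 0))"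
      proof (rule sum_norm_le, safe)
        fix x K
        assume xK: "(x, K) \<in> p"
        have "x \<in> K" "K \<subseteq> {a..b}" using tagged_division_ofD(2,3)[OF p xK] by auto
        moreover obtain u v where K: "K = {u..v}"
          using tagged_division_ofD(4)[OF p xK] by auto
        ultimately have uv: "u \<le> x" "x \<le> v" "u \<in> {a..b}" "v \<in> {a..b}" "x \<in> {a..b}" "u \<le> v" by auto
        have in_ball: "norm (u - x) < d x" "norm (v - x) < d x"
        proof -
          have "u \<in> ball x (d x)" "v \<in> ball x (d x)"
            using fineD[OF fine xK] uv unfolding K by (meson atLeastAtMost_iff order_refl subsetD)+
          then show "norm (u - x) < d x" "norm (v - x) < d x"
            by (simp_all add: dist_real_def abs_minus_commute)
        qed
        show "norm (measure lborel K *\<^sub>R h0 x - (F (Sup K) - F (Inf K)))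
          \<le> e1 * (Sup K - Inf K) + (if x \<in> N then norm (F (Sup K) - F (Inf K)) else 0)"
        proof (cases "x \<in> N")
          case True
          then show ?thesis using uv e1(1) by (simp add: h0_def K norm_minus_commute)
        next
          case False
          \<comment> \<open>Straddling: the tag x lies between u and v, so the errors at the two
            ends add up to e1 (v - u).\<close>
          have "norm ((v - u) *\<^sub>R h x - (F v - F u))
            = norm ((F u - F x - (u - x) *\<^sub>R h x) - (F v - F x - (v - x) *\<^sub>R h x))"
            by (simp add: algebra_simps)
          also have "\<dots> \<le> e1 * norm (u - x) + e1 * norm (v - x)"
            using dd[OF uv(5) False uv(3) in_ball(1)] dd[OF uv(5) False uv(4) in_ball(2)]
            by (rule order_trans[OF norm_triangle_ineq4 add_mono])
          also have "\<dots> = e1 * (v - u)" using uv by (simp add: algebra_simps)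
          finally show ?thesis using False uv by (simp add: h0_def K)
        qed
      qed
      also have "\<dots> = e1 * (\<Sum>(x,K)\<in>p. Sup K - Inf K) + (\<Sum>(x, K)\<in>p. if x \<in> N then norm (F (Sup K) - F (Inf K)) else 0)"
        by (simp add: split_def sum.distrib sum_distrib_left)
      also have "(\<Sum>(x, K)\<in>p. if x \<in> N then norm (F (Sup K) - F (Inf K)) else 0)
         = (\<Sum>(x, K)\<in>q. norm (F (Sup K) - F (Inf K)))"
        unfolding q_def split_def using fin
        by (subst sum.inter_filter[symmetric]) auto
      also have "e1 * (\<Sum>(x,K)\<in>p. Sup K - Inf K) + (\<Sum>(x, K)\<in>q. norm (F (Sup K) - F (Inf K))) < e"
        using e1(2) qsum unfolding ba(1)[symmetric] by linarith
      finally show "norm ((\<Sum>(x, k)\<in>p. measure lborel k *\<^sub>R h0 x) - (F b - F a)) < e"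
        by (simp add: ba(2) split_def sum_subtractf)
    qed
  qed
  then show ?thesis
    by (rule has_integral_spike[OF N, rotated]) (simp add: h0_def)
qed

section \<open>Lipschitz functions, sums, and the passage to classical derivatives\<close>

lemma lipschitz_on_imp_abs_continuous_on_interval:
  fixes g :: "real \<Rightarrow> 'a::real_normed_vector"
  assumes "L-lipschitz_on {a..b} g"
  shows "abs_continuous_on_interval a b g"
  unfolding abs_continuous_on_interval_def
proof (intro allI impI)
  fix e :: real assume e: "e > 0"
  have L: "L \<ge> 0" using assms by (rule lipschitz_on_nonneg)
  show "\<exists>d>0. \<forall>D. D division_of \<Union>D \<and> \<Union>D \<subseteq> {a..b} \<and> (\<Sum>K\<in>D. Sup K - Inf K) < d \<longrightarrow>
        (\<Sum>K\<in>D. norm (g (Sup K) - g (Inf K))) < e"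
  proof (intro exI[of _ "e / (L + 1)"] conjI allI impI; (elim conjE)?)
    show "e / (L + 1) > 0" using e L by simp
    fix D assume D: "D division_of \<Union>D" "\<Union>D \<subseteq> {a..b}" "(\<Sum>K\<in>D. Sup K - Inf K) < e / (L + 1)"
    have *: "norm (g (Sup K) - g (Inf K)) \<le> L * (Sup K - Inf K) \<and> 0 \<le> Sup K - Inf K" if KD: "K \<in> D" for K
    proof -
      obtain u v where K: "K = {u..v}" "u \<le> v"
        using division_ofD(3,4)[OF D(1) KD] by fastforce
      have "K \<subseteq> {a..b}" using KD D(2) by auto
      then have "u \<in> {a..b}" "v \<in> {a..b}" using K by auto
      then have "norm (g v - g u) \<le> L * (v - u)"
        using lipschitz_onD[OF assms, of v u] K(2) by (simp add: dist_norm)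
      then show ?thesis using K by simp
    qed
    have "(\<Sum>K\<in>D. norm (g (Sup K) - g (Inf K))) \<le> (\<Sum>K\<in>D. (L + 1) * (Sup K - Inf K))"
      using * by (intro sum_mono) (force simp: algebra_simps)
    also have "\<dots> = (L + 1) * (\<Sum>K\<in>D. Sup K - Inf K)" by (simp add: sum_distrib_left)
    also have "\<dots> < (L + 1) * (e / (L + 1))" using D(3) L by (intro mult_strict_left_mono) auto
    also have "\<dots> = e" using L by simp
    finally show "(\<Sum>K\<in>D. norm (g (Sup K) - g (Inf K))) < e" .
  qed
qed

lemma abs_continuous_on_interval_add:
  assumes "abs_continuous_on_interval a b F" "abs_continuous_on_interval a b G"
  shows "abs_continuous_on_interval a b (\<lambda>t. F t + G t)"
  unfolding abs_continuous_on_interval_def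
proof (intro allI impI)
  fix e :: real assume "e > 0"
  then have e: "e / 2 > 0" by simp
  obtain d1 where d1: "d1 > 0" "\<And>D. D division_of \<Union>D \<Longrightarrow> \<Union>D \<subseteq> {a..b} \<Longrightarrow> (\<Sum>K\<in>D. Sup K - Inf K) < d1 \<Longrightarrow>
        (\<Sum>K\<in>D. norm (F (Sup K) - F (Inf K))) < e / 2"
    using assms(1) e unfolding abs_continuous_on_interval_def by meson
  obtain d2 where d2: "d2 > 0" "\<And>D. D division_of \<Union>D \<Longrightarrow> \<Union>D \<subseteq> {a..b} \<Longrightarrow> (\<Sum>K\<in>D. Sup K - Inf K) < d2 \<Longrightarrow>
        (\<Sum>K\<in>D. norm (G (Sup K) - G (Inf K))) < e / 2"
    using assms(2) e unfolding abs_continuous_on_interval_def by meson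
  show "\<exists>d>0. \<forall>D. D division_of \<Union>D \<and> \<Union>D \<subseteq> {a..b} \<and> (\<Sum>K\<in>D. Sup K - Inf K) < d \<longrightarrow>
        (\<Sum>K\<in>D. norm (F (Sup K) + G (Sup K) - (F (Inf K) + G (Inf K)))) < e"
  proof (intro exI[of _ "min d1 d2"] conjI allI impI; (elim conjE)?)
    show "min d1 d2 > 0" using d1 d2 by simp
    fix D assume D: "D division_of \<Union>D" "\<Union>D \<subseteq> {a..b}" "(\<Sum>K\<in>D. Sup K - Inf K) < min d1 d2"
    have "(\<Sum>K\<in>D. norm (F (Sup K) + G (Sup K) - (F (Inf K) + G (Inf K))))
        \<le> (\<Sum>K\<in>D. norm (F (Sup K) - F (Inf K)) + norm (G (Sup K) - G (Inf K)))"
      by (intro sum_mono) (metis add_diff_add norm_triangle_ineq)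
    also have "\<dots> < e" using d1(2)[of D] d2(2)[of D] D by (simp add: sum.distrib)
    finally show "(\<Sum>K\<in>D. norm (F (Sup K) + G (Sup K) - (F (Inf K) + G (Inf K)))) < e" .
  qed
qed

text \<open>The fundamental theorem writes every increment of F as an integral of h, and by
  continuity the averages of h converge at every point.\<close>

lemma loc_abs_continuous_from_derivative:
  fixes F :: "real \<Rightarrow> 'a::real_normed_vector"
  assumes F: "loc_abs_continuous_from t0 F" and h: "continuous_on {t0..} h"
    and ae: "AE t in lebesgue. t \<ge> t0 \<longrightarrow> (F has_vector_derivative h t) (at t within {t0..})"
    and t: "t \<ge> t0"
  shows "(F has_vector_derivative h t) (at t within {t0..})"
proof -
  obtain N where N: "negligible N"
    and der: "\<And>t. t \<notin> N \<Longrightarrow> t \<ge> t0 \<Longrightarrow> (F has_vector_derivative h t) (at t within {t0..})"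
    using ae unfolding eventually_ae_filter_negligible by blast
  have int: "(h has_integral F s - F r) {r..s}" if "t0 \<le> r" "r \<le> s" for r s
  proof (rule fundamental_theorem_of_calculus_abs_continuous[OF _ that(2) N])
    have "abs_continuous_on_interval t0 s F"
      using F that by (auto simp: loc_abs_continuous_from_def)
    then show "abs_continuous_on_interval r s F"
      unfolding abs_continuous_on_interval_def
      by (elim all_forward imp_forward ex_forward conj_forward) (use that in auto)
    show "(F has_vector_derivative h u) (at u within {r..s})" if "u \<in> {r..s} - N" for u
      using der[of u] that \<open>t0 \<le> r\<close> by (auto intro: has_vector_derivative_within_subset)
  qed
  show ?thesis
    unfolding has_vector_derivative_def has_derivative_within_alt
  proof (intro conjI allI impI)
    show "bounded_linear (\<lambda>x. x *\<^sub>R h t)" by (rule bounded_linear_scaleR_left)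
    fix e :: real assume e: "e > 0"
    then obtain d where d: "d > 0" "\<And>s. s \<ge> t0 \<Longrightarrow> norm (s - t) < d \<Longrightarrow> norm (h s - h t) < e"
      using h t unfolding continuous_on_iff by (metis atLeast_iff dist_norm)
    have *: "norm (F s - F r - (s - r) *\<^sub>R h t) \<le> e * (s - r)"
      if "t0 \<le> r" "r \<le> s" "\<And>u. u \<in> {r..s} \<Longrightarrow> norm (u - t) < d" for r s
    proof -
      have "((\<lambda>u. h u - h t) has_integral (F s - F r) - (s - r) *\<^sub>R h t) {r..s}"
        using int[OF that(1,2)] has_integral_const_real[of "h t" r s] that(2)
        by (intro has_integral_diff) auto
      then have "norm (F s - F r - (s - r) *\<^sub>R h t) \<le> e * measure lborel {r..s}"
        using d(2) that e by (intro has_integral_bound_real[where S="{}"]) (auto intro: less_imp_le)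
      then show ?thesis using that by simp
    qed
    show "\<exists>d>0. \<forall>y\<in>{t0..}. norm (y - t) < d \<longrightarrow> norm (F y - F t - (y - t) *\<^sub>R h t) \<le> e * norm (y - t)"
    proof (intro exI[of _ d] conjI ballI impI d(1))
      fix y assume y: "y \<in> {t0..}" "norm (y - t) < d"
      show "norm (F y - F t - (y - t) *\<^sub>R h t) \<le> e * norm (y - t)"
      proof (cases "t \<le> y")
        case True
        then show ?thesis using *[of t y] y t by auto
      next
        case False
        have "norm (F y - F t - (y - t) *\<^sub>R h t) = norm (F t - F y - (t - y) *\<^sub>R h t)"
          by (subst norm_minus_cancel[symmetric]) (simp add: algebra_simps)
        then show ?thesis using *[of y t] y t False by auto
      qed
    qed
  qed
qed

section \<open>Almost everywhere differentiability of Lipschitz curves\<close>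

lemma negligible_uminus_image:
  fixes N :: "real set"
  assumes "negligible N"
  shows "negligible (uminus ` N)"
proof (rule negligible_locally_Lipschitz_image[OF _ assms])
  fix x :: real
  show "\<exists>T B. open T \<and> x \<in> T \<and> (\<forall>y\<in>N \<inter> T. norm (- y - - x) \<le> B * norm (y - x))"
    by (rule exI[of _ UNIV], rule exI[of _ 1]) (auto simp: abs_minus_commute)
qed simp

section \<open>Real functions: Lebesgue differentiation and densities\<close>

text \<open>One-sided, because Lebesgue differentiation is used here in the form of averages over
  [x, x + h].\<close>

definition has_right_difference_limit :: "(real \<Rightarrow> real) \<Rightarrow> real \<Rightarrow> real \<Rightarrow> bool" where
  "has_right_difference_limit F l x \<longleftrightarrow>
     (\<forall>e>0. \<exists>d>0. \<forall>h. 0 < h \<and> h < d \<longrightarrow> \<bar>(F (x + h) - F x) / h - l\<bar> < e)"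

lemma has_right_difference_limit_indefinite_integral_ae:
  fixes r F :: "real \<Rightarrow> real"
  assumes int: "\<And>a b. a \<le> b \<Longrightarrow> (r has_integral F b - F a) {a..b}"
  shows "\<exists>N. negligible N \<and> (\<forall>x. x \<notin> N \<longrightarrow> has_right_difference_limit F (r x) x)"
proof (rule integrable_ccontinuous_explicit[of r])
  show "r integrable_on cbox a b" for a b :: real
    using int[of a b] by (cases "a \<le> b") (auto simp: integrable_on_def)
next
  fix N :: "real set"
  assume N: "negligible N" and lim: "\<And>x e. x \<notin> N \<Longrightarrow> 0 < e \<Longrightarrow>
      \<exists>d>0. \<forall>h. 0 < h \<and> h < d \<longrightarrow> norm (integral (cbox x (x + h *\<^sub>R One)) r /\<^sub>R h ^ DIM(real) - r x) < e"
  have eq: "norm (integral (cbox x (x + h *\<^sub>R One)) r /\<^sub>R h ^ DIM(real) - r x)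
      = \<bar>(F (x + h) - F x) / h - r x\<bar>" if "0 < h" for x h
  proof -
    have "integral (cbox x (x + h *\<^sub>R One)) r = F (x + h) - F x"
      using int[of x "x + h"] that by (simp add: integral_unique)
    then show ?thesis by (simp add: divide_inverse mult.commute)
  qed
  have "has_right_difference_limit F (r x) x" if "x \<notin> N" for x
    unfolding has_right_difference_limit_def
  proof (intro allI impI)
    fix e :: real assume "e > 0"
    from lim[OF that this] obtain d where "d > 0" and
      d: "\<And>h. 0 < h \<and> h < d \<Longrightarrow> norm (integral (cbox x (x + h *\<^sub>R One)) r /\<^sub>R h ^ DIM(real) - r x) < e"
      by auto
    have "\<bar>(F (x + h) - F x) / h - r x\<bar> < e" if "0 < h \<and> h < d" for h
      using d[OF that] eq[of h x] that by argo
    with \<open>d > 0\<close> show "\<exists>d>0. \<forall>h. 0 < h \<and> h < d \<longrightarrow> \<bar>(F (x + h) - F x) / h - r x\<bar> < e"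
      by auto
  qed
  with N show ?thesis by auto
qed

text \<open>Left difference quotients of F at x are right ones of y \<mapsto> - F (- y) at -x. The
  one-sided statement is thus applied twice, and the second null set is reflected back.\<close>

lemma has_real_derivative_indefinite_integral_ae:
  fixes r F :: "real \<Rightarrow> real"
  assumes int: "\<And>a b. a \<le> b \<Longrightarrow> (r has_integral F b - F a) {a..b}"
  shows "\<exists>N. negligible N \<and> (\<forall>x. x \<notin> N \<longrightarrow> (F has_real_derivative r x) (at x))"
proof -
  obtain N1 where N1: "negligible N1" "\<forall>x. x \<notin> N1 \<longrightarrow> has_right_difference_limit F (r x) x"
    using has_right_difference_limit_indefinite_integral_ae[OF int] by auto
  have "((\<lambda>x. r (- x)) has_integral (- F (- b)) - (- F (- a))) {a..b}" if "a \<le> b" for a b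
    using has_integral_reflect_lemma_real[OF int[of "-b" "-a"]] that by simp
  from has_right_difference_limit_indefinite_integral_ae[OF this]
  obtain N2 where N2: "negligible N2"
    "\<forall>x. x \<notin> N2 \<longrightarrow> has_right_difference_limit (\<lambda>x. - F (- x)) (r (- x)) x"
    by auto
  show ?thesis
  proof (intro exI[of _ "N1 \<union> uminus ` N2"] conjI allI impI)
    show "negligible (N1 \<union> uminus ` N2)"
      using N1(1) N2(1) by (intro negligible_Un negligible_uminus_image)
    fix x assume x: "x \<notin> N1 \<union> uminus ` N2"
    have "x \<notin> N1" "- x \<notin> N2"
      using x by (auto simp: image_iff intro: bexI[of _ "- x"])
    show "(F has_real_derivative r x) (at x)"
      unfolding DERIV_def LIM_eq
    proof (intro allI impI)
      fix e :: real assume e: "e > 0"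
      obtain d1 where d1: "d1 > 0" "\<And>h. 0 < h \<Longrightarrow> h < d1 \<Longrightarrow> \<bar>(F (x + h) - F x) / h - r x\<bar> < e"
        using N1(2) \<open>x \<notin> N1\<close> e unfolding has_right_difference_limit_def by meson
      obtain d2 where d2: "d2 > 0" "\<And>h. 0 < h \<Longrightarrow> h < d2 \<Longrightarrow> \<bar>(F x - F (x - h)) / h - r x\<bar> < e"
      proof -
        have "has_right_difference_limit (\<lambda>x. - F (- x)) (r x) (- x)"
          using N2(2) \<open>- x \<notin> N2\<close> by force
        then show ?thesis
          using e that unfolding has_right_difference_limit_def by simp (metis add.commute uminus_add_conv_diff)
      qed
      show "\<exists>s>0. \<forall>h. h \<noteq> 0 \<and> norm (h - 0) < s \<longrightarrow> norm ((F (x + h) - F x) / h - r x) < e"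
      proof (intro exI[of _ "min d1 d2"] conjI allI impI)
        show "min d1 d2 > 0" using d1 d2 by simp
        fix h :: real assume h: "h \<noteq> 0 \<and> norm (h - 0) < min d1 d2"
        show "norm ((F (x + h) - F x) / h - r x) < e"
        proof (cases "h > 0")
          case True
          then show ?thesis using d1(2)[of h] h by simp
        next
          case False
          then have "(F (x + h) - F x) / h = (F x - F (x - (- h))) / (- h)"
            by (simp add: minus_divide_left)
          then show ?thesis using d2(2)[of "- h"] h False by simp
        qed
      qed
    qed
  qed
qed

text \<open>The density is the Radon-Nikodym derivative of the image of Lebesgue measure under the
  inverse of \<open>F\<close>.\<close>

lemma expanding_lipschitz_real_is_indefinite_integral:
  fixes F :: "real \<Rightarrow> real"
  assumes c: "c > 0" and lo: "\<And>x y. x \<le> y \<Longrightarrow> c * (y - x) \<le> F y - F x"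
    and hi: "\<And>x y. x \<le> y \<Longrightarrow> F y - F x \<le> C * (y - x)"
  obtains r where "\<And>a b. a \<le> b \<Longrightarrow> (r has_integral F b - F a) {a..b}"
proof -
  have mono: "F x < F y" if "x < y" for x y
  proof -
    have "0 < c * (y - x)" using c that by simp
    with lo[of x y] that show ?thesis by simp
  qed
  have lip: "\<bar>F y - F x\<bar> \<le> C * \<bar>y - x\<bar>" for x y
  proof (cases x y rule: linorder_cases)
    case less
    then show ?thesis using hi[of x y] mono[of x y] by simp
  next
    case greater
    then show ?thesis using hi[of y x] mono[of y x] by simp
  qed simp
  have Flip: "C-lipschitz_on UNIV F"
  proof (rule lipschitz_onI)
    show "C \<ge> 0" using lip[of 1 0] by simp
  qed (use lip in \<open>simp add: dist_real_def\<close>)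
  have cont: "continuous_on A F" for A
    by (rule lipschitz_on_continuous_on[OF lipschitz_on_subset[OF Flip subset_UNIV]])
  have "\<exists>x. F x = y" for y
  proof -
    \<comment> \<open>Expansion by the factor c carries F past -|y| and |y| within distance k of 0,
      so the intermediate value theorem gives surjectivity.\<close>
    define k where "k = (\<bar>y\<bar> + \<bar>F 0\<bar>) / c"
    have k: "k \<ge> 0" "c * k = \<bar>y\<bar> + \<bar>F 0\<bar>" using c by (auto simp: k_def)
    have Fk: "F (- k) \<le> y" "y \<le> F k" using lo[of 0 k] lo[of "-k" 0] k by simp_all
    have "- k \<le> k" using k(1) by simp
    from IVT'[of F "-k" y k, OF Fk this cont] show ?thesis by auto
  qed
  then obtain G where "\<forall>y. F (G y) = y" by (rule choice[OF allI, THEN exE])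
  then have FG: "F (G y) = y" for y by simp
  have GF: "G (F x) = x" for x
    using FG[of "F x"] mono[of "G (F x)" x] mono[of x "G (F x)"] by (cases x "G (F x)" rule: linorder_cases) simp_all
  have G_vimage: "G -` A = F ` A" for A
  proof (intro equalityI subsetI)
    fix y assume "y \<in> G -` A"
    then have "F (G y) \<in> F ` A" by simp
    then show "y \<in> F ` A" by (simp only: FG)
  qed (auto simp: GF)
  have F_le: "F x \<le> F y \<longleftrightarrow> x \<le> y" for x y
    using mono[of x y] mono[of y x] by (cases x y rule: linorder_cases) simp_all
  have "mono G"
  proof (rule monoI)
    fix x y :: real assume "x \<le> y"
    then show "G x \<le> G y" using F_le[of "G x" "G y"] FG by simp
  qed
  then have Gm[measurable]: "G \<in> borel_measurable borel" by (rule borel_measurable_mono)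
  define \<nu> where "\<nu> = distr lborel borel G"
  have \<nu>_sets: "sets \<nu> = sets lborel" by (simp add: \<nu>_def)
  have \<nu>: "emeasure \<nu> A = emeasure lborel (F ` A)" if "A \<in> sets borel" for A
  proof -
    have "G -` A = F ` A" using G_vimage .
    then show ?thesis using that by (simp add: \<nu>_def emeasure_distr)
  qed
  have \<nu>_Icc: "emeasure \<nu> {a..b} = ennreal (F b - F a)" if "a \<le> b" for a b
  proof -
    have "F ` {a..b} = {F a..F b}"
    proof (intro equalityI subsetI)
      fix y assume "y \<in> {F a..F b}"
      then have "G y \<in> {a..b}" using F_le[of a "G y"] F_le[of "G y" b] FG by simp
      then have "F (G y) \<in> F ` {a..b}" by (rule imageI)
      then show "y \<in> F ` {a..b}" by (simp only: FG)
    next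
      fix y assume "y \<in> F ` {a..b}"
      then obtain x where "y = F x" "a \<le> x" "x \<le> b" by auto
      then show "y \<in> {F a..F b}" using F_le[of a x] F_le[of x b] by simp
    qed
    then show ?thesis using \<nu>[of "{a..b}"] that F_le[of a b] by simp
  qed
  \<comment> \<open>\<nu> measures A by the length of F(A), and Lipschitz maps send null sets to
    null sets.\<close>
  have "absolutely_continuous lborel \<nu>"
    unfolding absolutely_continuous_def
  proof
    fix A assume A: "A \<in> null_sets (lborel :: real measure)"
    then have Ab: "A \<in> sets borel" by auto
    have "negligible A" using A by (simp add: negligible_iff_null_sets null_sets_completionI)
    then have "negligible (F ` A)"
    proof (rule negligible_locally_Lipschitz_image[rotated])
      fix x
      show "\<exists>T B. open T \<and> x \<in> T \<and> (\<forall>y\<in>A \<inter> T. norm (F y - F x) \<le> B * norm (y - x))"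
        using lip by (intro exI[of _ UNIV] exI[of _ C]) auto
    qed simp
    moreover have "F ` A \<in> sets borel"
    proof -
      have "F ` A = G -` A \<inter> space borel" using G_vimage by simp
      then show ?thesis using measurable_sets[OF Gm Ab] by simp
    qed
    ultimately have "emeasure lborel (F ` A) = 0"
      by (simp add: negligible_iff_emeasure0)
    then show "A \<in> null_sets \<nu>" using \<nu>[OF Ab] Ab by (intro null_setsI) (auto simp: \<nu>_def)
  qed
  then obtain \<rho> where [measurable]: "\<rho> \<in> borel_measurable lborel" and \<rho>: "density lborel \<rho> = \<nu>"
    using sigma_finite_measure.Radon_Nikodym[OF sigma_finite_lborel, of \<nu>] \<nu>_sets by auto
  show thesis
  proof
    fix a b :: real assume ab: "a \<le> b"
    have I: "(\<integral>\<^sup>+x. \<rho> x * indicator {a..b} x \<partial>lborel) = ennreal (F b - F a)"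
      using \<nu>_Icc[OF ab] by (simp add: \<rho>[symmetric] emeasure_density)
    \<comment> \<open>The density may be infinite, but only on a null subset of the interval, so
      passing to \<open>enn2real\<close> leaves the integral unchanged.\<close>
    then have "AE x in lborel. \<rho> x * indicator {a..b} x \<noteq> \<infinity>"
      by (intro nn_integral_noteq_infinite) auto
    then have "AE x in lborel. ennreal (enn2real (\<rho> x) * indicator {a..b} x) = \<rho> x * indicator {a..b} x"
    proof eventually_elim
      case (elim x)
      then show ?case
        by (cases "x \<in> {a..b}") (simp_all add: ennreal_enn2real_if)
    qed
    then have nn: "(\<integral>\<^sup>+x. ennreal (enn2real (\<rho> x) * indicator {a..b} x) \<partial>lborel) = ennreal (F b - F a)"
      unfolding I[symmetric] by (rule nn_integral_cong_AE)
    have eq: "(\<lambda>x. enn2real (\<rho> x) * indicator {a..b} x) = (\<lambda>x. if x \<in> {a..b} then enn2real (\<rho> x) else 0)"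
      by (auto simp: fun_eq_iff)
    from nn have "((\<lambda>x. enn2real (\<rho> x) * indicator {a..b} x) has_integral F b - F a) UNIV"
      using F_le[of a b] ab by (intro nn_integral_has_integral) auto
    then show "((\<lambda>x. enn2real (\<rho> x)) has_integral F b - F a) {a..b}"
      unfolding eq by (simp only: has_integral_restrict_UNIV)
  qed
qed

text \<open>Adding 2 c x moves all slopes between c and 3 c, which makes the function expanding and
  an indefinite integral; the linear term is removed again after differentiation. The choice c = L +
  1 is positive even for L = 0.\<close>

lemma lipschitz_real_derivative_ae:
  fixes f :: "real \<Rightarrow> real"
  assumes "L-lipschitz_on UNIV f"
  shows "\<exists>N h. negligible N \<and> (\<forall>x. x \<notin> N \<longrightarrow> (f has_real_derivative h x) (at x))"
proof -
  define c where "c = L + 1"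
  have c: "c > 0" "L \<le> c" using lipschitz_on_nonneg[OF assms] by (auto simp: c_def)
  have f: "\<bar>f y - f x\<bar> \<le> c * (y - x)" if "x \<le> y" for x y
  proof -
    have "\<bar>f y - f x\<bar> \<le> L * (y - x)"
      using lipschitz_onD[OF assms, of y x] that by (simp add: dist_real_def)
    also have "\<dots> \<le> c * (y - x)" using c that by (intro mult_right_mono) auto
    finally show ?thesis .
  qed
  define F where "F x = f x + 2 * c * x" for x
  have "c * (y - x) \<le> F y - F x" "F y - F x \<le> (3 * c) * (y - x)" if "x \<le> y" for x y
    using f[OF that] by (simp_all add: F_def abs_le_iff algebra_simps)
  then obtain r where "\<And>a b. a \<le> b \<Longrightarrow> (r has_integral F b - F a) {a..b}"
    using expanding_lipschitz_real_is_indefinite_integral[OF c(1)] by metis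
  then obtain N where N: "negligible N" "\<And>x. x \<notin> N \<Longrightarrow> (F has_real_derivative r x) (at x)"
    using has_real_derivative_indefinite_integral_ae[of r F] by auto
  have "(f has_real_derivative r x - 2 * c) (at x)" if "x \<notin> N" for x
  proof -
    have "((\<lambda>x. F x - 2 * c * x) has_real_derivative r x - 2 * c) (at x)"
      by (rule derivative_eq_intros N(2)[OF that] refl | simp)+
    then show ?thesis by (simp add: F_def)
  qed
  with N(1) show ?thesis by (intro exI[of _ N] exI[of _ "\<lambda>x. r x - 2 * c"]) simp
qed

lemma indefinite_integral_exists:
  fixes r :: "real \<Rightarrow> real"
  assumes r: "\<And>a b. r integrable_on {a..b}"
  shows "\<exists>M. \<forall>a b. a \<le> b \<longrightarrow> (r has_integral M b - M a) {a..b}"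
proof -
  \<comment> \<open>Signed primitive: at most one of the two integrals runs over a nondegenerate
    interval.\<close>
  define M where "M t = integral {0..t} r - integral {t..0} r" for t
  have "integral {a..b} r = M b - M a" if ab: "a \<le> b" for a b
  proof -
    have comb: "integral {u..v} r + integral {v..w} r = integral {u..w} r" if "u \<le> v" "v \<le> w" for u v w
      using that r by (rule Henstock_Kurzweil_Integration.integral_combine)
    have neg: "integral {u..v} r = 0" if "v \<le> u" for u v
      using that by (cases "u = v") auto
    consider "0 \<le> a" | "a \<le> 0" "0 \<le> b" | "b \<le> 0" by linarith
    then show ?thesis
    proof cases
      case 1
      then show ?thesis using comb[of 0 a b] neg[of 0 a] neg[of 0 b] ab by (simp add: M_def)
    next
      case 2
      then show ?thesis using comb[of a 0 b] neg[of a 0] neg[of 0 b] by (simp add: M_def)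
    next
      case 3
      then show ?thesis using comb[of a b 0] neg[of a 0] neg[of b 0] ab by (simp add: M_def)
    qed
  qed
  then have "(r has_integral M b - M a) {a..b}" if "a \<le> b" for a b
    using that integrable_integral[OF r[of a b]] by simp
  then show ?thesis by (intro exI[of _ M]) simp
qed

section \<open>From real components to curves in a Hilbert space\<close>

text \<open>The directions are the normalised increments between rational times. They are countable,
  so that the exceptional null sets of the components can be united, and continuity of g makes them
  suffice even when the space is not separable.\<close>

lemma lipschitz_norming_sequence:
  fixes g :: "real \<Rightarrow> 'a::real_inner"
  assumes g: "L-lipschitz_on UNIV g"
  shows "\<exists>e :: nat \<Rightarrow> 'a. (\<forall>n. norm (e n) \<le> 1) \<and>
    (\<forall>s t. \<forall>\<epsilon>>0. \<exists>n. norm (g t - g s) - \<epsilon> < inner (g t - g s) (e n))"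
proof -
  define E where "E = (\<lambda>(s, t). sgn (g t - g s)) ` (\<rat> \<times> \<rat>)"
  have "countable E" unfolding E_def using countable_rat by (intro countable_image countable_SIGMA) auto
  moreover have "E \<noteq> {}" unfolding E_def using Rats_0 by blast
  ultimately have rangeE: "range (from_nat_into E) = E" by (rule range_from_nat_into[rotated])
  have 1: "norm (from_nat_into E n) \<le> 1" for n
  proof -
    have "from_nat_into E n \<in> E" using rangeE by auto
    then show ?thesis by (auto simp: E_def norm_sgn)
  qed
  have 2: "\<exists>n. norm (g t - g s) - \<epsilon> < inner (g t - g s) (from_nat_into E n)" if \<epsilon>: "\<epsilon> > 0" for s t \<epsilon>
  proof -
    \<comment> \<open>Rational times cost up to 2 L \<delta> in the norm of the increment and 2 L
      \<delta> in the inner product; 4 L \<delta> < \<epsilon> absorbs both.\<close>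
    define \<delta> where "\<delta> = \<epsilon> / (4 * L + 1)"
    have L: "L \<ge> 0" using g by (rule lipschitz_on_nonneg)
    then have \<delta>: "\<delta> > 0" "4 * (L * \<delta>) < \<epsilon>" using \<epsilon> by (auto simp: \<delta>_def field_simps)
    have approx: "\<exists>u'\<in>\<rat>. norm (g u - g u') \<le> L * \<delta>" for u
    proof -
      obtain u' where "u' \<in> \<rat>" "u < u'" "u' < u + \<delta>" using Rats_dense_in_real[of u "u + \<delta>"] \<delta> by auto
      moreover from this have "norm (g u - g u') \<le> L * \<delta>"
        using lipschitz_onD[OF g, of u u'] L mult_left_mono[of "dist u u'" \<delta> L]
        by (auto simp: dist_norm dist_real_def)
      ultimately show ?thesis by blast
    qed
    obtain s' t' where st: "s' \<in> \<rat>" "norm (g s - g s') \<le> L * \<delta>" "t' \<in> \<rat>" "norm (g t - g t') \<le> L * \<delta>"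
      using approx[of s] approx[of t] by blast
    define v where "v = g t' - g s'"
    have "sgn v \<in> E" using st by (auto simp: E_def v_def)
    then obtain n where n: "from_nat_into E n = sgn v" using rangeE by (metis imageE)
    have diff: "norm ((g t - g s) - v) \<le> 2 * (L * \<delta>)"
    proof -
      have eq: "(g t - g s) - v = (g t - g t') - (g s - g s')" by (simp add: v_def)
      show ?thesis unfolding eq using norm_triangle_ineq4[of "g t - g t'" "g s - g s'"] st by simp
    qed
    have "inner v (sgn v) = norm v"
      by (cases "v = 0") (auto simp: sgn_div_norm power2_norm_eq_inner[symmetric] power2_eq_square)
    moreover have "\<bar>inner ((g t - g s) - v) (sgn v)\<bar> \<le> norm ((g t - g s) - v) * 1"
      by (rule order_trans[OF Cauchy_Schwarz_ineq2 mult_left_mono]) (auto simp: norm_sgn)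
    moreover have "norm (g t - g s) \<le> norm v + norm ((g t - g s) - v)"
      using norm_triangle_ineq[of v "(g t - g s) - v"] by simp
    ultimately have "norm (g t - g s) - \<epsilon> < inner (g t - g s) (sgn v)"
      using diff \<delta>(2) by (simp add: inner_diff_left)
    then show ?thesis using n by metis
  qed
  show ?thesis by (intro exI[of _ "from_nat_into E"] conjI allI impI 1 2)
qed

lemma has_real_derivative_lipschitz_bound:
  fixes f :: "real \<Rightarrow> real"
  assumes "(f has_real_derivative D) (at x)" "L-lipschitz_on UNIV f"
  shows "\<bar>D\<bar> \<le> L"
proof -
  have "((\<lambda>y. \<bar>(f y - f x) / (y - x)\<bar>) \<longlongrightarrow> \<bar>D\<bar>) (at x)"
    using assms(1) unfolding has_field_derivative_iff by (rule tendsto_rabs)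
  moreover have "eventually (\<lambda>y. \<bar>(f y - f x) / (y - x)\<bar> \<le> L) (at x)"
    unfolding eventually_at
  proof (intro exI[of _ 1] conjI ballI impI)
    fix y assume "y \<noteq> x \<and> dist y x < 1"
    then show "\<bar>(f y - f x) / (y - x)\<bar> \<le> L"
      using lipschitz_onD[OF assms(2), of y x] by (simp add: dist_real_def pos_divide_le_eq)
  qed simp
  ultimately show ?thesis
    by (rule tendsto_upperbound) simp
qed

text \<open>Difference quotients of a curve in a Hilbert space converge as soon as their norms are
  asymptotically bounded by some \<open>m\<close> while their components along suitable unit vectors come
  arbitrarily close to \<open>m\<close>: the parallelogram law then makes them Cauchy.\<close>

lemma has_vector_derivative_parallelogram:
  fixes g :: "real \<Rightarrow> 'a::{real_inner, complete_space}"
  assumes up: "\<And>\<epsilon>. \<epsilon> > 0 \<Longrightarrow> eventually (\<lambda>y. norm ((g y - g t) /\<^sub>R (y - t)) < m + \<epsilon>) (at t)"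
    and lo: "\<And>\<epsilon>. \<epsilon> > 0 \<Longrightarrow> \<exists>e. norm e \<le> 1 \<and> eventually (\<lambda>y. m - \<epsilon> < inner ((g y - g t) /\<^sub>R (y - t)) e) (at t)"
  shows "\<exists>d. (g has_vector_derivative d) (at t)"
proof -
  define D where "D y = (g y - g t) /\<^sub>R (y - t)" for y
  have m: "m \<ge> 0"
  proof (rule ccontr)
    assume "\<not> m \<ge> 0"
    then have "eventually (\<lambda>y. norm (D y) < m + (- m)) (at t)" using up[of "-m"] by (simp add: D_def)
    then have "eventually (\<lambda>y. False) (at t)" by eventually_elim simp
    then show False by simp
  qed
  have cauchy: "\<exists>\<delta>>0. \<forall>y z. y \<noteq> t \<and> dist y t < \<delta> \<and> z \<noteq> t \<and> dist z t < \<delta> \<longrightarrow> norm (D y - D z) < \<eta>"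
    if \<eta>: "\<eta> > 0" for \<eta>
  proof -
    \<comment> \<open>The squared distance will be at most 16 \<epsilon> (m + 1); the 32 turns this
      into half of \<eta>^2, and the bound 1 allows \<epsilon>^2 \<le> \<epsilon>.\<close>
    define \<epsilon> where "\<epsilon> = min 1 (\<eta>\<^sup>2 / (32 * (m + 1)))"
    have \<epsilon>: "\<epsilon> > 0" "\<epsilon> \<le> 1" using \<eta> m by (auto simp: \<epsilon>_def)
    have small: "16 * \<epsilon> * (m + 1) < \<eta>\<^sup>2"
    proof -
      have "16 * \<epsilon> * (m + 1) \<le> 16 * (\<eta>\<^sup>2 / (32 * (m + 1))) * (m + 1)"
        using m by (intro mult_right_mono mult_left_mono) (auto simp: \<epsilon>_def)
      also have "\<dots> = \<eta>\<^sup>2 / 2" using m by (simp add: field_simps)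
      also have "\<dots> < \<eta>\<^sup>2" using \<eta> by simp
      finally show ?thesis .
    qed
    obtain e where e: "norm e \<le> 1" "eventually (\<lambda>y. m - \<epsilon> < inner (D y) e) (at t)"
      using lo[OF \<epsilon>(1)] by (auto simp: D_def)
    have "eventually (\<lambda>y. norm (D y) < m + \<epsilon> \<and> m - \<epsilon> < inner (D y) e) (at t)"
      using up[OF \<epsilon>(1)] e(2) by (auto simp: D_def intro: eventually_conj)
    then obtain \<delta> where \<delta>: "\<delta> > 0"
      "\<And>y. y \<noteq> t \<Longrightarrow> dist y t < \<delta> \<Longrightarrow> norm (D y) < m + \<epsilon> \<and> m - \<epsilon> < inner (D y) e"
      unfolding eventually_at by auto
    have "norm (D y - D z) < \<eta>" if "y \<noteq> t" "dist y t < \<delta>" "z \<noteq> t" "dist z t < \<delta>" for y z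
    proof -
      have y: "norm (D y) < m + \<epsilon>" "m - \<epsilon> < inner (D y) e" using \<delta>(2)[OF that(1,2)] by auto
      have z: "norm (D z) < m + \<epsilon>" "m - \<epsilon> < inner (D z) e" using \<delta>(2)[OF that(3,4)] by auto
      have sq: "(norm (D y))\<^sup>2 \<le> (m + \<epsilon>)\<^sup>2" "(norm (D z))\<^sup>2 \<le> (m + \<epsilon>)\<^sup>2"
        using y(1) z(1) by (auto intro: power_mono)
      have "inner (D y + D z) e \<le> norm (D y + D z) * norm e" by (rule norm_cauchy_schwarz)
      also have "\<dots> \<le> norm (D y + D z)" using e(1) by (simp add: mult_left_le)
      finally have sum: "2 * (m - \<epsilon>) \<le> norm (D y + D z)"
        using y z by (simp add: inner_add_left)
      \<comment> \<open>Weaker than squaring \<open>sum\<close>, which is not possible when m <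
        \<epsilon>; in that case the left-hand side is nonpositive.\<close>
      have sum2: "4 * (m\<^sup>2 - 2 * m * \<epsilon> - \<epsilon>\<^sup>2) \<le> (norm (D y + D z))\<^sup>2"
      proof (cases "m \<ge> \<epsilon>")
        case True
        have "(2 * (m - \<epsilon>))\<^sup>2 \<le> (norm (D y + D z))\<^sup>2" using sum True by (intro power_mono) auto
        then show ?thesis by (simp add: power2_eq_square algebra_simps) (smt (verit) mult_nonneg_nonneg \<epsilon>(1))
      next
        case False
        have "m\<^sup>2 \<le> \<epsilon>\<^sup>2" using False m by (intro power_mono) auto
        moreover have "0 \<le> 2 * m * \<epsilon>" using m \<epsilon> by simp
        ultimately have "m\<^sup>2 - 2 * m * \<epsilon> - \<epsilon>\<^sup>2 \<le> 0" by linarith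
        then have "4 * (m\<^sup>2 - 2 * m * \<epsilon> - \<epsilon>\<^sup>2) \<le> 0" by (rule mult_nonneg_nonpos[rotated]) simp
        then show ?thesis by (rule order_trans) simp
      qed
      have "(norm (D y - D z))\<^sup>2 = 2 * (norm (D y))\<^sup>2 + 2 * (norm (D z))\<^sup>2 - (norm (D y + D z))\<^sup>2"
        unfolding power2_norm_eq_inner
        by (simp add: inner_add_left inner_add_right inner_diff_left inner_diff_right inner_commute)
      also have "\<dots> \<le> 4 * (m + \<epsilon>)\<^sup>2 - 4 * (m\<^sup>2 - 2 * m * \<epsilon> - \<epsilon>\<^sup>2)"
        using sq sum2 by linarith
      also have "\<dots> = 16 * m * \<epsilon> + 8 * (\<epsilon> * \<epsilon>)" by (simp add: power2_eq_square algebra_simps)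
      also have "\<dots> \<le> 16 * \<epsilon> * (m + 1)"
      proof -
        have "\<epsilon> * \<epsilon> \<le> \<epsilon> * 1" using \<epsilon> by (intro mult_left_mono) auto
        then show ?thesis using \<epsilon> by (simp add: algebra_simps)
      qed
      also have "\<dots> < \<eta>\<^sup>2" by (rule small)
      finally show ?thesis using \<eta> by (simp add: power_less_imp_less_base)
    qed
    then show ?thesis using \<delta>(1) by blast
  qed
  \<comment> \<open>One sequence tending to t suffices to produce the limit; \<open>cauchy\<close>
    transfers it to all nearby y.\<close>
  define Y where "Y n = t + 1 / real (Suc n)" for n
  have Yt: "Y n \<noteq> t" "dist (Y n) t = 1 / real (Suc n)" for n by (auto simp: Y_def dist_real_def)
  have Ylim: "eventually (\<lambda>n. dist (Y n) t < \<delta>) sequentially" if "\<delta> > 0" for \<delta>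
  proof -
    have "(\<lambda>n. 1 / real (Suc n)) \<longlonglongrightarrow> 0" using LIMSEQ_inverse_real_of_nat by (simp add: inverse_eq_divide)
    then show ?thesis using that unfolding Yt by (rule order_tendstoD)
  qed
  have "Cauchy (\<lambda>n. D (Y n))"
  proof (rule metric_CauchyI)
    fix \<eta> :: real assume "\<eta> > 0"
    then obtain \<delta> where \<delta>: "\<delta> > 0" "\<forall>y z. y \<noteq> t \<and> dist y t < \<delta> \<and> z \<noteq> t \<and> dist z t < \<delta> \<longrightarrow> norm (D y - D z) < \<eta>"
      using cauchy by blast
    obtain N where "\<forall>n\<ge>N. dist (Y n) t < \<delta>" using Ylim[OF \<delta>(1)] by (auto simp: eventually_sequentially)
    then show "\<exists>M. \<forall>m\<ge>M. \<forall>n\<ge>M. dist (D (Y m)) (D (Y n)) < \<eta>"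
      using \<delta>(2) Yt(1) by (intro exI[of _ N]) (simp add: dist_norm)
  qed
  then obtain d where d: "(\<lambda>n. D (Y n)) \<longlonglongrightarrow> d" by (auto simp: Cauchy_convergent_iff convergent_def)
  have "(g has_vector_derivative d) (at t)"
    unfolding has_vector_derivative_def has_derivative_at_alt
  proof (intro conjI allI impI)
    show "bounded_linear (\<lambda>x. x *\<^sub>R d)" by (rule bounded_linear_scaleR_left)
    fix \<eta> :: real assume \<eta>: "\<eta> > 0"
    then obtain \<delta> where \<delta>: "\<delta> > 0" "\<forall>y z. y \<noteq> t \<and> dist y t < \<delta> \<and> z \<noteq> t \<and> dist z t < \<delta> \<longrightarrow> norm (D y - D z) < \<eta>"
      using cauchy by blast
    show "\<exists>\<delta>>0. \<forall>y. norm (y - t) < \<delta> \<longrightarrow> norm (g y - g t - (y - t) *\<^sub>R d) \<le> \<eta> * norm (y - t)"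
    proof (intro exI[of _ \<delta>] conjI allI impI \<delta>(1))
      fix y assume y: "norm (y - t) < \<delta>"
      show "norm (g y - g t - (y - t) *\<^sub>R d) \<le> \<eta> * norm (y - t)"
      proof (cases "y = t")
        case False
        have "(\<lambda>n. norm (D y - D (Y n))) \<longlonglongrightarrow> norm (D y - d)"
          by (intro tendsto_intros d)
        moreover have "eventually (\<lambda>n. norm (D y - D (Y n)) \<le> \<eta>) sequentially"
          using Ylim[OF \<delta>(1)]
        proof eventually_elim
          case (elim n)
          then show ?case using \<delta>(2)[rule_format, of y "Y n"] Yt(1) False y by (simp add: dist_norm)
        qed
        ultimately have "norm (D y - d) \<le> \<eta>"
          by (rule tendsto_upperbound) simp
        moreover have "g y - g t - (y - t) *\<^sub>R d = (y - t) *\<^sub>R (D y - d)"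
          using False by (simp add: D_def scaleR_diff_right)
        ultimately show ?thesis using mult_left_mono[of "norm (D y - d)" \<eta> "\<bar>y - t\<bar>"]
          by (simp add: mult.commute)
      qed simp
    qed
  qed
  then show ?thesis by blast
qed

text \<open>The supremum \<open>m\<close> of the component derivatives is the metric speed of the
  curve. By the norming property, increments of g are bounded by those of the primitive
  \<open>M\<close> of \<open>m\<close>. Differentiating \<open>M\<close> bounds the norms of
  difference quotients asymptotically by m t, while some component comes within \<epsilon> of it:
  the situation of the parallelogram criterion.\<close>

lemma lipschitz_has_vector_derivative_ae:
  fixes g :: "real \<Rightarrow> 'a::{real_inner, complete_space}"
  assumes g: "L-lipschitz_on UNIV g"
  shows "\<exists>N. negligible N \<and> (\<forall>t. t \<notin> N \<longrightarrow> (\<exists>d. (g has_vector_derivative d) (at t)))"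
proof -
  obtain e :: "nat \<Rightarrow> 'a" where e1: "\<forall>n. norm (e n) \<le> 1"
    and e2: "\<forall>s t. \<forall>\<epsilon>>0. \<exists>n. norm (g t - g s) - \<epsilon> < inner (g t - g s) (e n)"
    using lipschitz_norming_sequence[OF g] by auto
  define \<psi> where "\<psi> n t = inner (g t) (e n)" for n t
  have L: "L \<ge> 0" using g by (rule lipschitz_on_nonneg)
  have \<psi>: "L-lipschitz_on UNIV (\<psi> n)" for n
  proof (rule lipschitz_onI[OF _ L])
    fix s t
    have "dist (\<psi> n s) (\<psi> n t) = \<bar>inner (g s - g t) (e n)\<bar>"
      by (simp add: \<psi>_def dist_real_def inner_diff_left)
    also have "\<dots> \<le> norm (g s - g t) * norm (e n)" by (rule Cauchy_Schwarz_ineq2)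
    also have "\<dots> \<le> norm (g s - g t)" using e1 by (simp add: mult_left_le)
    also have "\<dots> \<le> L * dist s t" using lipschitz_onD[OF g, of s t] by (simp add: dist_norm)
    finally show "dist (\<psi> n s) (\<psi> n t) \<le> L * dist s t" .
  qed
  have "\<forall>n. \<exists>N h. negligible N \<and> (\<forall>x. x \<notin> N \<longrightarrow> (\<psi> n has_real_derivative h x) (at x))"
    using lipschitz_real_derivative_ae[OF \<psi>] by simp
  from choice[OF this] obtain NN where "\<forall>n. \<exists>h. negligible (NN n) \<and> (\<forall>x. x \<notin> NN n \<longrightarrow> (\<psi> n has_real_derivative h x) (at x))"
    by auto
  from choice[OF this] obtain hh where NN: "\<And>n. negligible (NN n)"
    and hh: "\<And>n x. x \<notin> NN n \<Longrightarrow> (\<psi> n has_real_derivative hh n x) (at x)"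
    by auto
  define N where "N = (\<Union>n. NN n)"
  have N: "negligible N" unfolding N_def using NN by (rule negligible_Union_nat)
  \<comment> \<open>The value 0 on the exceptional set keeps the bound by L, and with it the
    supremum over n, valid at every t.\<close>
  define h where "h n t = (if t \<in> N then 0 else hh n t)" for n t
  have h_der: "(\<psi> n has_real_derivative h n t) (at t)" if "t \<notin> N" for n t
    using hh[of t n] that by (auto simp: h_def N_def)
  have h_le: "\<bar>h n t\<bar> \<le> L" for n t
    using has_real_derivative_lipschitz_bound[OF h_der \<psi>, of t n] L by (cases "t \<in> N") (auto simp: h_def)
  have h_int: "(h n has_integral \<psi> n b - \<psi> n a) {a..b}" if "a \<le> b" for n a b
  proof (rule fundamental_theorem_of_calculus_abs_continuous[OF _ that N])
    show "abs_continuous_on_interval a b (\<psi> n)"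
      by (rule lipschitz_on_imp_abs_continuous_on_interval[OF lipschitz_on_subset[OF \<psi> subset_UNIV]])
    show "(\<psi> n has_vector_derivative h n t) (at t within {a..b})" if "t \<in> {a..b} - N" for t
      using h_der[of t n] that
      by (auto simp: has_real_derivative_iff_has_vector_derivative intro: has_vector_derivative_at_within)
  qed
  define m where "m t = (SUP n. h n t)" for t
  have bdd: "bdd_above (range (\<lambda>n. h n t))" for t
    using h_le by (intro bdd_aboveI[of _ L]) (auto simp: abs_le_iff)
  have h_m: "h n t \<le> m t" for n t
    unfolding m_def by (rule cSUP_upper[OF _ bdd]) simp
  have m_le: "\<bar>m t\<bar> \<le> L" for t
  proof -
    have "m t \<le> L" unfolding m_def using h_le by (intro cSUP_least) (auto simp: abs_le_iff)
    moreover have "- L \<le> m t" using h_m[of 0 t] h_le[of 0 t] by linarith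
    ultimately show ?thesis by simp
  qed
  have "m integrable_on {a..b}" for a b
  proof (cases "a \<le> b")
    case True
    have "m \<in> borel_measurable (lebesgue_on {a..b})"
      unfolding m_def
    proof (rule borel_measurable_cSUP)
      show "h n \<in> borel_measurable (lebesgue_on {a..b})" for n
        using h_int[OF True] by (intro integrable_imp_measurable) (auto simp: integrable_on_def)
    qed (use bdd in auto)
    then show ?thesis
      by (rule measurable_bounded_by_integrable_imp_integrable[where g="\<lambda>_. L"]) (use m_le in auto)
  qed (simp add: integrable_on_empty)
  then obtain M where M: "\<And>a b. a \<le> b \<Longrightarrow> (m has_integral M b - M a) {a..b}"
    using indefinite_integral_exists[of m] by auto
  obtain NM where NM: "negligible NM" "\<forall>x. x \<notin> NM \<longrightarrow> (M has_real_derivative m x) (at x)"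
    using has_real_derivative_indefinite_integral_ae[OF M] by auto
  have gM: "norm (g b - g a) \<le> M b - M a" if ab: "a \<le> b" for a b
  proof (rule field_le_epsilon)
    fix \<epsilon> :: real assume "\<epsilon> > 0"
    then obtain n where n: "norm (g b - g a) - \<epsilon> < inner (g b - g a) (e n)" using e2 by blast
    have "inner (g b - g a) (e n) = \<psi> n b - \<psi> n a" by (simp add: \<psi>_def inner_diff_left)
    also have "\<dots> \<le> M b - M a"
      using h_m by (intro has_integral_le[OF h_int[OF ab] M[OF ab]])
    finally show "norm (g b - g a) \<le> M b - M a + \<epsilon>" using n by simp
  qed
  have "\<exists>d. (g has_vector_derivative d) (at t)" if "t \<notin> N \<union> NM" for t
  proof (rule has_vector_derivative_parallelogram[where m="m t"])
    fix \<epsilon> :: real assume \<epsilon>: "\<epsilon> > 0"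
    have "((\<lambda>y. (M y - M t) / (y - t)) \<longlongrightarrow> m t) (at t)"
      using NM(2) that by (simp add: has_field_derivative_iff)
    then have "eventually (\<lambda>y. (M y - M t) / (y - t) < m t + \<epsilon>) (at t)"
      by (rule order_tendstoD) (use \<epsilon> in simp)
    then show "eventually (\<lambda>y. norm ((g y - g t) /\<^sub>R (y - t)) < m t + \<epsilon>) (at t)"
      using eventually_neq_at_within[of t]
    proof eventually_elim
      case (elim y)
      have "norm ((g y - g t) /\<^sub>R (y - t)) = norm (g y - g t) / \<bar>y - t\<bar>"
        by (simp add: divide_inverse mult.commute)
      also have "\<dots> \<le> (M y - M t) / (y - t)"
      proof (cases "t \<le> y")
        case True
        then show ?thesis using gM[OF True] elim by (simp add: divide_right_mono)
      next
        case False
        then have "norm (g y - g t) / \<bar>y - t\<bar> \<le> (M t - M y) / (t - y)"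
          using gM[of y t] by (simp add: norm_minus_commute divide_right_mono)
        also have "\<dots> = (M y - M t) / (y - t)" using False by (simp add: field_simps)
        finally show ?thesis .
      qed
      finally show ?case using elim by simp
    qed
    have "m t - \<epsilon> < m t" using \<epsilon> by simp
    then obtain n where n: "m t - \<epsilon> < h n t"
      unfolding m_def by (subst (asm) less_cSUP_iff[OF _ bdd]) auto
    have "((\<lambda>y. (\<psi> n y - \<psi> n t) / (y - t)) \<longlongrightarrow> h n t) (at t)"
      using h_der[of t n] that by (simp add: has_field_derivative_iff)
    then have "eventually (\<lambda>y. m t - \<epsilon> < (\<psi> n y - \<psi> n t) / (y - t)) (at t)"
      using n by (rule order_tendstoD)
    moreover have "(\<psi> n y - \<psi> n t) / (y - t) = inner ((g y - g t) /\<^sub>R (y - t)) (e n)" for y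
      by (simp add: \<psi>_def inner_diff_left divide_inverse mult.commute)
    ultimately show "\<exists>e. norm e \<le> 1 \<and> eventually (\<lambda>y. m t - \<epsilon> < inner ((g y - g t) /\<^sub>R (y - t)) e) (at t)"
      using e1 by (intro exI[of _ "e n"]) simp
  qed
  then show ?thesis
    using N NM(1) by (intro exI[of _ "N \<union> NM"]) auto
qed

section \<open>Initial value problems on a half-line\<close>

lemma at_within_atLeastAtMost_eq_atLeast:
  fixes t :: real
  assumes "t < T"
  shows "at t within {a..T} = at t within {a..}"
  by (rule at_within_nhd[of t "{..<T}"]) (use assms in auto)

lemma continuous_on_atLeast:
  fixes f :: "real \<Rightarrow> 'a::topological_space"
  assumes "\<And>T. T \<ge> a \<Longrightarrow> continuous_on {a..T} f"
  shows "continuous_on {a..} f"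
  unfolding continuous_on_def
proof
  fix t assume t: "t \<in> {a..}"
  then have "(f \<longlongrightarrow> f t) (at t within {a..t + 1})"
    using assms[of "t + 1"] by (simp add: continuous_on_def)
  then show "(f \<longlongrightarrow> f t) (at t within {a..})"
    by (simp add: at_within_atLeastAtMost_eq_atLeast)
qed

lemma integral_has_vector_derivative_atLeast:
  fixes h :: "real \<Rightarrow> 'a::banach"
  assumes "continuous_on {a..} h" "t \<ge> a"
  shows "((\<lambda>u. integral {a..u} h) has_vector_derivative h t) (at t within {a..})"
proof -
  have "((\<lambda>u. integral {a..u} h) has_vector_derivative h t) (at t within {a..t + 1})"
    using assms by (intro integral_has_vector_derivative) (auto intro: continuous_on_subset)
  then show ?thesis by (simp add: at_within_atLeastAtMost_eq_atLeast)
qed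

section \<open>Picard iteration\<close>

text \<open>\<open>cont\<close> asks for continuity along continuous curves, which is what makes the
  integral operator well defined. \<open>lip\<close> is global in the state with a constant
  depending on T alone, which rules out blow-up in finite time.\<close>

locale picard =
  fixes \<Phi> :: "real \<Rightarrow> 'b::banach \<Rightarrow> 'b" and t0 :: real and z0 :: 'b
  assumes cont: "\<And>z. continuous_on {t0..} z \<Longrightarrow> continuous_on {t0..} (\<lambda>t. \<Phi> t (z t))"
    and lip: "\<And>T. \<exists>K>0. \<forall>t\<in>{t0..T}. \<forall>z w. norm (\<Phi> t z - \<Phi> t w) \<le> K * norm (z - w)"
begin

definition P :: "(real \<Rightarrow> 'b) \<Rightarrow> real \<Rightarrow> 'b" where
  "P z t = z0 + integral {t0..t} (\<lambda>s. \<Phi> s (z s))"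

lemma P_derivative:
  assumes "continuous_on {t0..} z" "t \<ge> t0"
  shows "(P z has_vector_derivative \<Phi> t (z t)) (at t within {t0..})"
  unfolding P_def
  using integral_has_vector_derivative_atLeast[OF cont[OF assms(1)] assms(2)]
  by (auto intro: derivative_eq_intros)

lemma P_continuous: "continuous_on {t0..} z \<Longrightarrow> continuous_on {t0..} (P z)"
  by (rule continuous_on_vector_derivative) (auto intro: P_derivative)

text \<open>With the exponential weight, \<open>P\<close> contracts by the factor \<open>1/2\<close> on every bounded interval.\<close>

lemma P_contraction:
  assumes K: "K > 0" "\<forall>t\<in>{t0..T}. \<forall>z w. norm (\<Phi> t z - \<Phi> t w) \<le> K * norm (z - w)"
    and zw: "continuous_on {t0..} z" "continuous_on {t0..} w"
    and C: "C \<ge> 0" "\<And>s. s \<in> {t0..T} \<Longrightarrow> norm (z s - w s) \<le> C * exp (2 * K * (s - t0))"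
    and t: "t \<in> {t0..T}"
  shows "norm (P z t - P w t) \<le> C / 2 * exp (2 * K * (t - t0))"
proof -
  have int: "(\<lambda>s. \<Phi> s (z s)) integrable_on {t0..t}" "(\<lambda>s. \<Phi> s (w s)) integrable_on {t0..t}"
    using cont[OF zw(1)] cont[OF zw(2)]
    by (auto intro!: integrable_continuous_real elim: continuous_on_subset)
  define E where "E s = C / 2 * exp (2 * K * (s - t0))" for s
  have "((\<lambda>s. C * K * exp (2 * K * (s - t0))) has_integral E t - E t0) {t0..t}"
  proof (rule fundamental_theorem_of_calculus)
    show "t0 \<le> t" using t by simp
    fix s assume "s \<in> {t0..t}"
    have "(E has_real_derivative C * K * exp (2 * K * (s - t0))) (at s within {t0..t})"
      unfolding E_def by (auto intro!: derivative_eq_intros)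
    then show "(E has_vector_derivative C * K * exp (2 * K * (s - t0))) (at s within {t0..t})"
      by (simp add: has_real_derivative_iff_has_vector_derivative)
  qed
  note E = this
  have "P z t - P w t = integral {t0..t} (\<lambda>s. \<Phi> s (z s) - \<Phi> s (w s))"
    by (simp add: P_def Henstock_Kurzweil_Integration.integral_diff[OF int])
  also have "norm \<dots> \<le> integral {t0..t} (\<lambda>s. C * K * exp (2 * K * (s - t0)))"
  proof (rule Henstock_Kurzweil_Integration.integral_norm_bound_integral)
    show "(\<lambda>s. \<Phi> s (z s) - \<Phi> s (w s)) integrable_on {t0..t}"
      using int by (rule integrable_diff)
    show "(\<lambda>s. C * K * exp (2 * K * (s - t0))) integrable_on {t0..t}" using E by auto
    fix s assume "s \<in> {t0..t}"
    then have s: "s \<in> {t0..T}" using t by auto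
    have "norm (\<Phi> s (z s) - \<Phi> s (w s)) \<le> K * norm (z s - w s)" using K(2) s by blast
    also have "\<dots> \<le> K * (C * exp (2 * K * (s - t0)))"
      using C(2)[OF s] K(1) by (intro mult_left_mono) auto
    finally show "norm (\<Phi> s (z s) - \<Phi> s (w s)) \<le> C * K * exp (2 * K * (s - t0))"
      by (simp add: mult_ac)
  qed
  also have "\<dots> = E t - E t0" using E by (rule integral_unique)
  also have "\<dots> \<le> E t" using C(1) by (simp add: E_def)
  finally show ?thesis by (simp add: E_def)
qed

lemma bounded_diff:
  assumes "continuous_on {t0..} z" "continuous_on {t0..} w"
  obtains D where "D \<ge> 0" "\<And>s. s \<in> {t0..T} \<Longrightarrow> norm (z s - w s) \<le> D"
proof -
  have "continuous_on {t0..T} (\<lambda>s. z s - w s)"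
    using assms by (intro continuous_on_diff) (auto elim: continuous_on_subset)
  then have "bounded ((\<lambda>s. z s - w s) ` {t0..T})"
    by (intro compact_imp_bounded compact_continuous_image) auto
  then obtain D where "D > 0" "\<And>s. s \<in> {t0..T} \<Longrightarrow> norm (z s - w s) \<le> D"
    unfolding bounded_pos by auto
  then show thesis by (intro that[of D]) auto
qed

text \<open>Applying the contraction n times bounds the weighted distance of two fixed points by D /
  2^n.\<close>

lemma fixed_point_unique:
  assumes z: "continuous_on {t0..} z" "\<And>t. t \<ge> t0 \<Longrightarrow> P z t = z t"
    and w: "continuous_on {t0..} w" "\<And>t. t \<ge> t0 \<Longrightarrow> P w t = w t"
    and t: "t \<ge> t0"
  shows "z t = w t"
proof -
  obtain K where K: "K > 0" "\<forall>s\<in>{t0..t}. \<forall>z w. norm (\<Phi> s z - \<Phi> s w) \<le> K * norm (z - w)"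
    using lip by blast
  obtain D where D: "D \<ge> 0" "\<And>s. s \<in> {t0..t} \<Longrightarrow> norm (z s - w s) \<le> D"
    using bounded_diff[OF z(1) w(1)] by blast
  have bound: "norm (z s - w s) \<le> D / 2 ^ n * exp (2 * K * (s - t0))" if "s \<in> {t0..t}" for n s
    using that
  proof (induction n arbitrary: s)
    case 0
    \<comment> \<open>The weight is at least 1 on the interval, so a uniform bound is also a
      weighted one.\<close>
    have "D * 1 \<le> D * exp (2 * K * (s - t0))"
      using 0 D(1) K(1) by (intro mult_left_mono) auto
    then show ?case using D(2)[OF 0] by simp
  next
    case (Suc n)
    have "norm (P z s - P w s) \<le> (D / 2 ^ n) / 2 * exp (2 * K * (s - t0))"
      using P_contraction[OF K z(1) w(1) _ Suc.IH Suc.prems] D(1) by simp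
    then show ?case using z(2)[of s] w(2)[of s] Suc.prems by (simp add: mult.commute)
  qed
  have "(\<lambda>n. D / 2 ^ n * exp (2 * K * (t - t0))) \<longlonglongrightarrow> 0"
    using tendsto_mult[OF LIMSEQ_divide_realpow_zero[of 2 D] tendsto_const[of "exp (2 * K * (t - t0))"]] by simp
  then have "norm (z t - w t) \<le> 0"
    by (rule tendsto_lowerbound) (use bound t in \<open>auto intro: always_eventually\<close>)
  then show ?thesis by simp
qed

lemma fixed_point_exists: "\<exists>z. continuous_on {t0..} z \<and> (\<forall>t\<ge>t0. P z t = z t)"
proof -
  define Z where "Z n = (P ^^ n) (\<lambda>_. z0)" for n
  have Z0: "Z 0 = (\<lambda>_. z0)" and ZSuc: "Z (Suc n) = P (Z n)" for n by (simp_all add: Z_def)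
  have Zc: "continuous_on {t0..} (Z n)" for n
    by (induction n) (simp_all add: Z0 ZSuc P_continuous)
  \<comment> \<open>The telescoping series defines one function for all T, although K and D in the
    convergence estimate depend on T.\<close>
  define z where "z t = z0 + (\<Sum>n. Z (Suc n) t - Z n t)" for t
  have unif: "uniform_limit {t0..T} Z z sequentially" for T
  proof -
    obtain K where K: "K > 0" "\<forall>s\<in>{t0..T}. \<forall>z w. norm (\<Phi> s z - \<Phi> s w) \<le> K * norm (z - w)"
      using lip by blast
    obtain D where D: "D \<ge> 0" "\<And>s. s \<in> {t0..T} \<Longrightarrow> norm (Z 1 s - Z 0 s) \<le> D"
      using bounded_diff[OF Zc Zc] by blast
    have bound: "norm (Z (Suc n) s - Z n s) \<le> D / 2 ^ n * exp (2 * K * (s - t0))" if "s \<in> {t0..T}" for n s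
      using that
    proof (induction n arbitrary: s)
      case 0
      have "D * 1 \<le> D * exp (2 * K * (s - t0))"
        using 0 D(1) K(1) by (intro mult_left_mono) auto
      then show ?case using D(2)[OF 0] by simp
    next
      case (Suc n)
      have "norm (P (Z (Suc n)) s - P (Z n) s) \<le> (D / 2 ^ n) / 2 * exp (2 * K * (s - t0))"
        using P_contraction[OF K Zc Zc _ Suc.IH Suc.prems] D(1) by simp
      then show ?case by (simp add: ZSuc mult.commute)
    qed
    define E where "E = D * exp (2 * K * (T - t0))"
    have bound': "norm (Z (Suc n) s - Z n s) \<le> E * (1/2) ^ n" if "s \<in> {t0..T}" for n s
    proof -
      have "D / 2 ^ n * exp (2 * K * (s - t0)) \<le> D / 2 ^ n * exp (2 * K * (T - t0))"
        using D(1) K(1) that by (intro mult_left_mono) auto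
      moreover have "D / 2 ^ n * exp (2 * K * (T - t0)) = E * (1/2) ^ n"
        by (simp add: E_def power_divide)
      ultimately show ?thesis using bound[OF that, of n] by linarith
    qed
    have summ: "summable (\<lambda>n. E * (1/2) ^ n)"
      by (intro summable_mult summable_geometric) simp
    have "uniform_limit {t0..T} (\<lambda>n s. \<Sum>i<n. Z (Suc i) s - Z i s) (\<lambda>s. \<Sum>i. Z (Suc i) s - Z i s) sequentially"
      by (rule Weierstrass_m_test[OF bound' summ])
    then have "uniform_limit {t0..T} (\<lambda>n s. z0 + (\<Sum>i<n. Z (Suc i) s - Z i s)) z sequentially"
      unfolding z_def by (intro uniform_limit_add uniform_limit_const)
    moreover have "z0 + (\<Sum>i<n. Z (Suc i) s - Z i s) = Z n s" for n s
      by (simp add: sum_lessThan_telescope[of "\<lambda>i. Z i s"] Z0)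
    ultimately show ?thesis by (simp only:)
  qed
  have zc: "continuous_on {t0..} z"
  proof (rule continuous_on_atLeast)
    fix T
    show "continuous_on {t0..T} z"
      by (rule uniform_limit_theorem[OF _ unif]) (auto intro!: always_eventually continuous_on_subset[OF Zc])
  qed
  have "P z t = z t" if t: "t \<ge> t0" for t
  proof -
    obtain K where K: "K > 0" "\<forall>s\<in>{t0..t}. \<forall>z w. norm (\<Phi> s z - \<Phi> s w) \<le> K * norm (z - w)"
      using lip by blast
    define E where "E = exp (2 * K * (t - t0))"
    \<comment> \<open>The contraction estimate turns uniform convergence of Z n to z into
      convergence of P (Z n) to P z, so the shifted sequence has both P z t and z t as
      limits.\<close>
    have "(\<lambda>n. Z (Suc n) t) \<longlonglongrightarrow> P z t"
    proof (rule LIMSEQ_I)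
      fix r :: real assume r: "r > 0"
      define \<epsilon> where "\<epsilon> = r / E"
      have \<epsilon>: "\<epsilon> > 0" "\<epsilon> * E = r" using r by (auto simp: \<epsilon>_def E_def)
      obtain N where N: "\<And>n s. n \<ge> N \<Longrightarrow> s \<in> {t0..t} \<Longrightarrow> norm (Z n s - z s) < \<epsilon>"
        using unif[of t] \<epsilon>(1) unfolding uniform_limit_iff eventually_sequentially dist_norm by fast
      have "norm (Z (Suc n) t - P z t) < r" if n: "n \<ge> N" for n
      proof -
        have "norm (Z n s - z s) \<le> \<epsilon> * exp (2 * K * (s - t0))" if "s \<in> {t0..t}" for s
        proof -
          have "\<epsilon> * 1 \<le> \<epsilon> * exp (2 * K * (s - t0))" using \<epsilon>(1) K(1) that by (intro mult_left_mono) auto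
          then show ?thesis using N[OF n that] by simp
        qed
        then have "norm (P (Z n) t - P z t) \<le> \<epsilon> / 2 * exp (2 * K * (t - t0))"
          using \<epsilon>(1) t by (intro P_contraction[OF K Zc zc]) auto
        also have "\<dots> = r / 2" using \<epsilon>(2) by (simp add: E_def)
        finally show ?thesis using r by (simp add: ZSuc)
      qed
      then show "\<exists>N. \<forall>n\<ge>N. norm (Z (Suc n) t - P z t) < r" by blast
    qed
    moreover have "(\<lambda>n. Z (Suc n) t) \<longlonglongrightarrow> z t"
      by (rule LIMSEQ_Suc, rule tendsto_uniform_limitI[OF unif[of t]]) (use t in simp)
    ultimately show ?thesis by (rule LIMSEQ_unique)
  qed
  then show ?thesis using zc by (intro exI[of _ z]) simp
qed

lemma derivative_imp_fixed_point:
  assumes z: "z t0 = z0" "\<And>t. t \<ge> t0 \<Longrightarrow> (z has_vector_derivative \<Phi> t (z t)) (at t within {t0..})"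
    and t: "t \<ge> t0"
  shows "P z t = z t"
proof -
  have "((\<lambda>s. \<Phi> s (z s)) has_integral z t - z t0) {t0..t}"
  proof (rule fundamental_theorem_of_calculus[OF t])
    fix s assume "s \<in> {t0..t}"
    then show "(z has_vector_derivative \<Phi> s (z s)) (at s within {t0..t})"
      by (intro has_vector_derivative_within_subset[OF z(2)]) auto
  qed
  then show ?thesis by (simp add: P_def integral_unique z(1))
qed

lemma solution_exists:
  "\<exists>z. z t0 = z0 \<and> (\<forall>t\<ge>t0. (z has_vector_derivative \<Phi> t (z t)) (at t within {t0..}))"
proof -
  obtain z where z: "continuous_on {t0..} z" "\<forall>t\<ge>t0. P z t = z t"
    using fixed_point_exists by blast
  have "z t0 = z0" using z(2)[rule_format, of t0] by (simp add: P_def)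
  moreover have "(z has_vector_derivative \<Phi> t (z t)) (at t within {t0..})" if "t \<ge> t0" for t
    using P_derivative[OF z(1) that]
    by (rule has_vector_derivative_transform[rotated 2]) (use z(2) that in simp_all)
  ultimately show ?thesis by (intro exI[of _ z]) simp
qed

lemma solution_unique:
  assumes z: "z t0 = z0" "\<And>t. t \<ge> t0 \<Longrightarrow> (z has_vector_derivative \<Phi> t (z t)) (at t within {t0..})"
    and w: "w t0 = z0" "\<And>t. t \<ge> t0 \<Longrightarrow> (w has_vector_derivative \<Phi> t (w t)) (at t within {t0..})"
    and t: "t \<ge> t0"
  shows "z t = w t"
proof (rule fixed_point_unique[OF _ _ _ _ t])
  show "continuous_on {t0..} z" "continuous_on {t0..} w"
    using continuous_on_vector_derivative[of "{t0..}" z "\<lambda>t. \<Phi> t (z t)"]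
      continuous_on_vector_derivative[of "{t0..}" w "\<lambda>t. \<Phi> t (w t)"] z(2) w(2) by simp_all
  show "P z s = z s" if "s \<ge> t0" for s by (rule derivative_imp_fixed_point[OF z that])
  show "P w s = w s" if "s \<ge> t0" for s by (rule derivative_imp_fixed_point[OF w that])
qed

end

text \<open>A type of sort \<open>{real_normed_vector, complete_space}\<close> is not automatically of class
  \<open>banach\<close>, which the library demands for integrals of vector-valued functions. The
  following copy of such a type is.\<close>

typedef (overloaded) 'a as_banach = "UNIV :: 'a::{real_normed_vector, complete_space} set"
  morphisms of_banach to_banach ..

declare to_banach_inverse [simplified, simp] of_banach_inverse [simp]

lemma as_banach_eq_iff: "x = y \<longleftrightarrow> of_banach x = of_banach y"
  by (simp add: of_banach_inject)

instantiation as_banach :: ("{real_normed_vector, complete_space}") real_normed_vector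
begin

definition "0 = to_banach 0"
definition "x + y = to_banach (of_banach x + of_banach y)"
definition "x - y = to_banach (of_banach x - of_banach y)"
definition "- x = to_banach (- of_banach x)"
definition "c *\<^sub>R x = to_banach (c *\<^sub>R of_banach x)"
definition "norm x = norm (of_banach x)"
definition "dist x y = norm (of_banach x - of_banach y)"
definition "sgn x = to_banach (sgn (of_banach x))"
definition uniformity_as_banach :: "('a as_banach \<times> 'a as_banach) filter" where
  "uniformity_as_banach = (INF e\<in>{0<..}. principal {(x, y). dist x y < e})"
definition open_as_banach :: "'a as_banach set \<Rightarrow> bool" where
  "open_as_banach U \<longleftrightarrow> (\<forall>x\<in>U. eventually (\<lambda>(x', y). x' = x \<longrightarrow> y \<in> U) uniformity)"

instance
proof
  fix x y :: "'a as_banach"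
  show "norm (x + y) \<le> norm x + norm y"
    by (simp add: norm_as_banach_def plus_as_banach_def norm_triangle_ineq)
qed (simp_all add: as_banach_eq_iff zero_as_banach_def plus_as_banach_def minus_as_banach_def
    uminus_as_banach_def scaleR_as_banach_def norm_as_banach_def dist_as_banach_def sgn_as_banach_def
    uniformity_as_banach_def open_as_banach_def algebra_simps sgn_div_norm)

end

lemma bounded_linear_of_banach: "bounded_linear of_banach"
  by (rule bounded_linear_intro[of _ 1])
    (simp_all add: plus_as_banach_def scaleR_as_banach_def norm_as_banach_def)

lemma bounded_linear_to_banach: "bounded_linear to_banach"
  by (rule bounded_linear_intro[of _ 1])
    (simp_all add: plus_as_banach_def scaleR_as_banach_def norm_as_banach_def)

instance as_banach :: ("{real_normed_vector, complete_space}") banach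
proof
  fix X :: "nat \<Rightarrow> 'a as_banach"
  assume "Cauchy X"
  then have "Cauchy (\<lambda>n. of_banach (X n))"
    by (rule bounded_linear.Cauchy[OF bounded_linear_of_banach])
  then obtain l where "(\<lambda>n. of_banach (X n)) \<longlonglongrightarrow> l"
    by (auto simp: Cauchy_convergent_iff convergent_def)
  then have "(\<lambda>n. to_banach (of_banach (X n))) \<longlonglongrightarrow> to_banach l"
    by (rule bounded_linear.tendsto[OF bounded_linear_to_banach])
  then show "convergent X" by (auto simp: convergent_def)
qed

section \<open>Initial value problems in complete normed spaces\<close>

context
  fixes \<Phi> :: "real \<Rightarrow> 'c::{real_normed_vector, complete_space} \<Rightarrow> 'c" and t0 :: real
  assumes cont: "\<And>z. continuous_on {t0..} z \<Longrightarrow> continuous_on {t0..} (\<lambda>t. \<Phi> t (z t))"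
    and lip: "\<And>T. \<exists>K>0. \<forall>t\<in>{t0..T}. \<forall>z w. norm (\<Phi> t z - \<Phi> t w) \<le> K * norm (z - w)"
begin

lemma picard_as_banach: "picard (\<lambda>t z. to_banach (\<Phi> t (of_banach z))) t0"
proof
  fix z :: "real \<Rightarrow> 'c as_banach"
  assume "continuous_on {t0..} z"
  then have "continuous_on {t0..} (\<lambda>t. of_banach (z t))"
    by (rule bounded_linear.continuous_on[OF bounded_linear_of_banach])
  then show "continuous_on {t0..} (\<lambda>t. to_banach (\<Phi> t (of_banach (z t))))"
    by (intro bounded_linear.continuous_on[OF bounded_linear_to_banach] cont)
next
  fix T
  show "\<exists>K>0. \<forall>t\<in>{t0..T}. \<forall>z w. norm (to_banach (\<Phi> t (of_banach z)) - to_banach (\<Phi> t (of_banach w)))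
      \<le> K * norm (z - w)"
    using lip[of T] by (simp add: norm_as_banach_def minus_as_banach_def) blast
qed

lemma initial_value_problem_exists:
  "\<exists>z. z t0 = z0 \<and> (\<forall>t\<ge>t0. (z has_vector_derivative \<Phi> t (z t)) (at t within {t0..}))"
proof -
  obtain z where z: "z t0 = to_banach z0"
    "\<forall>t\<ge>t0. (z has_vector_derivative to_banach (\<Phi> t (of_banach (z t)))) (at t within {t0..})"
    using picard.solution_exists[OF picard_as_banach] by auto
  have "((\<lambda>t. of_banach (z t)) has_vector_derivative \<Phi> t (of_banach (z t))) (at t within {t0..})"
    if "t \<ge> t0" for t
    using bounded_linear.has_vector_derivative[OF bounded_linear_of_banach z(2)[rule_format, OF that]]
    by simp
  then show ?thesis by (intro exI[of _ "\<lambda>t. of_banach (z t)"]) (simp add: z(1))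
qed

lemma initial_value_problem_unique:
  assumes z: "\<And>t. t \<ge> t0 \<Longrightarrow> (z has_vector_derivative \<Phi> t (z t)) (at t within {t0..})"
    and w: "\<And>t. t \<ge> t0 \<Longrightarrow> (w has_vector_derivative \<Phi> t (w t)) (at t within {t0..})"
    and init: "z t0 = w t0" and t: "t \<ge> t0"
  shows "z t = w t"
proof -
  have "to_banach (z t) = to_banach (w t)"
  proof (rule picard.solution_unique[OF picard_as_banach _ _ _ _ t])
    show "((\<lambda>t. to_banach (z t)) has_vector_derivative to_banach (\<Phi> t (of_banach (to_banach (z t)))))
        (at t within {t0..})" if "t \<ge> t0" for t
      using bounded_linear.has_vector_derivative[OF bounded_linear_to_banach z[OF that]] by simp
    show "((\<lambda>t. to_banach (w t)) has_vector_derivative to_banach (\<Phi> t (of_banach (to_banach (w t)))))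
        (at t within {t0..})" if "t \<ge> t0" for t
      using bounded_linear.has_vector_derivative[OF bounded_linear_to_banach w[OF that]] by simp
  qed (simp_all add: init)
  then show ?thesis by (metis to_banach_inverse UNIV_I)
qed

end

section \<open>The inertial system\<close>

lemma loc_abs_continuous_from_imp_continuous_on:
  fixes g :: "real \<Rightarrow> 'a::real_normed_vector"
  assumes "loc_abs_continuous_from t0 g"
  shows "continuous_on {t0..} g"
proof (rule continuous_on_atLeast)
  fix T assume "T \<ge> t0"
  then have ac: "abs_continuous_on_interval t0 T g" using assms by (simp add: loc_abs_continuous_from_def)
  have close: "\<exists>d>0. \<forall>s t. s \<in> {t0..T} \<longrightarrow> t \<in> {t0..T} \<longrightarrow> s \<le> t \<longrightarrow> t - s < d \<longrightarrow> norm (g t - g s) < e"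
    if e: "e > 0" for e
  proof -
    obtain d where d: "d > 0" "\<And>D. D division_of \<Union>D \<Longrightarrow> \<Union>D \<subseteq> {t0..T} \<Longrightarrow> (\<Sum>K\<in>D. Sup K - Inf K) < d \<Longrightarrow>
        (\<Sum>K\<in>D. norm (g (Sup K) - g (Inf K))) < e"
      using ac e unfolding abs_continuous_on_interval_def by meson
    have "norm (g t - g s) < e" if "s \<in> {t0..T}" "t \<in> {t0..T}" "s \<le> t" "t - s < d" for s t
    proof -
      \<comment> \<open>A single interval is already a division, so absolute continuity contains
        uniform continuity.\<close>
      have "{{s..t}} division_of \<Union>{{s..t}}"
        using division_of_self[of s t] that(3) by simp
      from d(2)[OF this] show ?thesis using that by simp
    qed
    then show ?thesis using d(1) by blast
  qed
  show "continuous_on {t0..T} g"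
    unfolding continuous_on_iff
  proof (intro ballI allI impI)
    fix t e :: real assume t: "t \<in> {t0..T}" and e: "e > 0"
    obtain d where d: "d > 0" "\<forall>s t. s \<in> {t0..T} \<longrightarrow> t \<in> {t0..T} \<longrightarrow> s \<le> t \<longrightarrow> t - s < d \<longrightarrow> norm (g t - g s) < e"
      using close[OF e] by blast
    have "dist (g s) (g t) < e" if "s \<in> {t0..T}" "dist s t < d" for s
    proof (cases "s \<le> t")
      case True
      then show ?thesis using d(2)[rule_format, of s t] that t
        by (simp add: dist_norm norm_minus_commute dist_real_def)
    next
      case False
      then show ?thesis using d(2)[rule_format, of t s] that t
        by (simp add: dist_norm dist_real_def)
    qed
    then show "\<exists>d>0. \<forall>s\<in>{t0..T}. dist s t < d \<longrightarrow> dist (g s) (g t) < e"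
      using d(1) by blast
  qed
qed

lemma loc_abs_continuous_from_lipschitz:
  fixes g :: "real \<Rightarrow> 'a::real_normed_vector"
  assumes "\<And>T. \<exists>L. L-lipschitz_on {t0..T} g"
  shows "loc_abs_continuous_from t0 g"
  unfolding loc_abs_continuous_from_def
  using assms lipschitz_on_imp_abs_continuous_on_interval by blast

lemma continuous_derivative_imp_lipschitz:
  fixes x :: "real \<Rightarrow> 'a::real_normed_vector"
  assumes der: "\<And>t. t \<ge> t0 \<Longrightarrow> (x has_vector_derivative v t) (at t within {t0..})"
    and v: "continuous_on {t0..} v"
  shows "\<exists>L. L-lipschitz_on {t0..T} x"
proof -
  have "bounded (v ` {t0..T})"
    by (intro compact_imp_bounded compact_continuous_image continuous_on_subset[OF v]) auto
  then obtain L where L: "L > 0" "\<And>t. t \<in> {t0..T} \<Longrightarrow> norm (v t) \<le> L"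
    unfolding bounded_pos by auto
  have "L-lipschitz_on {t0..T} x"
  proof (rule bounded_derivative_imp_lipschitz)
    fix t assume t: "t \<in> {t0..T}"
    then have "(x has_vector_derivative v t) (at t within {t0..T})"
      by (intro has_vector_derivative_within_subset[OF der]) auto
    then show "(x has_derivative (\<lambda>h. h *\<^sub>R v t)) (at t within {t0..T})"
      by (simp add: has_vector_derivative_def)
    show "onorm (\<lambda>h. h *\<^sub>R v t) \<le> L"
    proof (rule onorm_bound)
      fix h
      have "norm (h *\<^sub>R v t) = norm (v t) * norm h" by (simp add: mult.commute)
      also have "\<dots> \<le> L * norm h" using L(2)[OF t] by (rule mult_right_mono) simp
      finally show "norm (h *\<^sub>R v t) \<le> L * norm h" .
    qed (use L(1) in simp)
  qed (use L(1) in auto)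
  then show ?thesis by blast
qed

text \<open>Clamping time to [t0, t0 + n] turns g into a curve that is Lipschitz on the whole line
  and agrees with g on that interval.\<close>

lemma locally_lipschitz_has_vector_derivative_ae:
  fixes g :: "real \<Rightarrow> 'a::{real_inner, complete_space}"
  assumes g: "\<And>T. \<exists>L. L-lipschitz_on {t0..T} g"
  shows "AE t in lebesgue. t \<ge> t0 \<longrightarrow> (\<exists>d. (g has_vector_derivative d) (at t within {t0..}))"
proof -
  define c where "c n t = max t0 (min (t0 + real n) t)" for n t
  have "\<exists>N. negligible N \<and> (\<forall>t. t \<notin> N \<longrightarrow> (\<exists>d. ((\<lambda>t. g (c n t)) has_vector_derivative d) (at t)))" for n
  proof -
    obtain L where L: "L-lipschitz_on {t0..t0 + real n} g" using g by blast
    have "L-lipschitz_on UNIV (\<lambda>t. g (c n t))"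
    proof (rule lipschitz_onI)
      show "L \<ge> 0" using L by (rule lipschitz_on_nonneg)
      fix s t :: real
      have "dist (g (c n s)) (g (c n t)) \<le> L * dist (c n s) (c n t)"
        using L by (rule lipschitz_onD) (auto simp: c_def)
      also have "\<dots> \<le> L * dist s t"
        using \<open>L \<ge> 0\<close> by (intro mult_left_mono) (auto simp: c_def dist_real_def)
      finally show "dist (g (c n s)) (g (c n t)) \<le> L * dist s t" .
    qed
    then show ?thesis by (rule lipschitz_has_vector_derivative_ae)
  qed
  then have "\<forall>n. \<exists>N. negligible N \<and> (\<forall>t. t \<notin> N \<longrightarrow> (\<exists>d. ((\<lambda>t. g (c n t)) has_vector_derivative d) (at t)))"
    by simp
  from choice[OF this] obtain N where N: "\<And>n. negligible (N n)"
    and der: "\<And>n t. t \<notin> N n \<Longrightarrow> \<exists>d. ((\<lambda>t. g (c n t)) has_vector_derivative d) (at t)"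
    by auto
  \<comment> \<open>\<open>t0\<close> joins the null set because the clamped curve coincides with g
    on a full neighbourhood only at interior points.\<close>
  have neg: "negligible (insert t0 (\<Union>n. N n))"
    using N by (simp add: negligible_insert negligible_Union_nat)
  have "\<exists>d. (g has_vector_derivative d) (at t within {t0..})"
    if t: "t \<notin> insert t0 (\<Union>n. N n)" "t \<ge> t0" for t
  proof -
    obtain n where n: "t - t0 < real n" using reals_Archimedean2 by blast
    obtain d where d: "((\<lambda>t. g (c n t)) has_vector_derivative d) (at t)"
      using der[of t n] t by auto
    have "(g has_vector_derivative d) (at t)"
    proof (rule has_vector_derivative_transform_within_open[OF d])
      show "open {t0<..<t0 + real n}" "t \<in> {t0<..<t0 + real n}" using n t by auto
      show "g (c n s) = g s" if "s \<in> {t0<..<t0 + real n}" for s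
        using that by (simp add: c_def)
    qed
    then show ?thesis using has_vector_derivative_at_within by blast
  qed
  then show ?thesis
    using neg unfolding eventually_ae_filter_negligible
    by (intro exI[of _ "insert t0 (\<Union>n. N n)"]) auto
qed

section \<open>Equivalence with the first-order system for an abstract field\<close>

text \<open>Abstracts the family of scaled envelope gradients. The weight 1 + norm y reflects their
  linear growth: the variation in time is uniformly Lipschitz on bounded sets.\<close>

locale inertial_system =
  fixes G :: "real \<Rightarrow> 'a::{real_inner, complete_space} \<Rightarrow> 'a" and t0 \<alpha> \<beta> :: real
  assumes t0: "t0 > 0" and G: "\<And>T. \<exists>L\<ge>0. \<forall>t\<in>{t0..T}. \<forall>s\<in>{t0..T}. \<forall>x y.
      norm (G t x - G s y) \<le> L * (norm (x - y) + \<bar>t - s\<bar> * (1 + norm y))"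
begin

lemma G_continuous:
  assumes z: "continuous_on {t0..} z"
  shows "continuous_on {t0..} (\<lambda>t. G t (z t))"
proof (rule continuous_on_atLeast)
  fix T
  obtain L where L: "\<forall>t\<in>{t0..T}. \<forall>s\<in>{t0..T}. \<forall>x y.
      norm (G t x - G s y) \<le> L * (norm (x - y) + \<bar>t - s\<bar> * (1 + norm y))"
    using G by blast
  show "continuous_on {t0..T} (\<lambda>t. G t (z t))"
    unfolding continuous_on_def
  proof
    fix t assume t: "t \<in> {t0..T}"
    have "continuous_on {t0..T} z" using z by (rule continuous_on_subset) auto
    then have "(z \<longlongrightarrow> z t) (at t within {t0..T})"
      using t by (simp add: continuous_on_def)
    then have "((\<lambda>s. L * (norm (z s - z t) + \<bar>s - t\<bar> * (1 + norm (z t)))) \<longlongrightarrow>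
        L * (norm (z t - z t) + \<bar>t - t\<bar> * (1 + norm (z t)))) (at t within {t0..T})"
      by (intro tendsto_intros)
    then have lim: "((\<lambda>s. L * (norm (z s - z t) + \<bar>s - t\<bar> * (1 + norm (z t)))) \<longlongrightarrow> 0) (at t within {t0..T})"
      by simp
    have "eventually (\<lambda>s. norm (G s (z s) - G t (z t)) \<le> L * (norm (z s - z t) + \<bar>s - t\<bar> * (1 + norm (z t))))
        (at t within {t0..T})"
      unfolding eventually_at_filter using L t by (intro always_eventually) simp
    then have "((\<lambda>s. G s (z s) - G t (z t)) \<longlongrightarrow> 0) (at t within {t0..T})"
      using lim by (rule Lim_null_comparison)
    then show "((\<lambda>s. G s (z s)) \<longlongrightarrow> G t (z t)) (at t within {t0..T})"
      by (rule Lim_null[THEN iffD2])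
  qed
qed

text \<open>The curve is bounded on a compact interval, which turns the weight 1 + norm y into a
  constant.\<close>

lemma G_lipschitz:
  assumes x: "\<And>T. \<exists>L. L-lipschitz_on {t0..T} x"
  shows "\<exists>L. L-lipschitz_on {t0..T} (\<lambda>t. G t (x t))"
proof -
  obtain M where M: "M-lipschitz_on {t0..T} x" using x by blast
  then have "bounded (x ` {t0..T})"
    by (intro compact_imp_bounded compact_continuous_image lipschitz_on_continuous_on) auto
  then obtain B where B: "B > 0" "\<And>t. t \<in> {t0..T} \<Longrightarrow> norm (x t) \<le> B"
    unfolding bounded_pos by auto
  obtain L where L: "L \<ge> 0" "\<forall>t\<in>{t0..T}. \<forall>s\<in>{t0..T}. \<forall>x y.
      norm (G t x - G s y) \<le> L * (norm (x - y) + \<bar>t - s\<bar> * (1 + norm y))"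
    using G by blast
  have "(L * (M + (1 + B)))-lipschitz_on {t0..T} (\<lambda>t. G t (x t))"
  proof (rule lipschitz_onI)
    fix t s assume ts: "t \<in> {t0..T}" "s \<in> {t0..T}"
    have "dist (G t (x t)) (G s (x s)) \<le> L * (norm (x t - x s) + \<bar>t - s\<bar> * (1 + norm (x s)))"
      using L(2) ts by (simp add: dist_norm)
    also have "\<dots> \<le> L * (M * \<bar>t - s\<bar> + \<bar>t - s\<bar> * (1 + B))"
      using lipschitz_onD[OF M ts] B(2)[OF ts(2)] L(1)
      by (intro mult_left_mono add_mono) (auto simp: dist_norm)
    also have "\<dots> = L * (M + (1 + B)) * dist t s" by (simp add: dist_real_def algebra_simps)
    finally show "dist (G t (x t)) (G s (x s)) \<le> L * (M + (1 + B)) * dist t s" .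
  qed (use L(1) B(1) lipschitz_on_nonneg[OF M] in simp)
  then show ?thesis by blast
qed

definition rhs :: "real \<Rightarrow> 'a \<times> 'a \<Rightarrow> 'a \<times> 'a" where
  "rhs t z = (snd z - \<beta> *\<^sub>R G t (fst z),
     (- (\<alpha> / t)) *\<^sub>R snd z + ((\<alpha> * \<beta> - \<beta>) / t - 1) *\<^sub>R G t (fst z))"

lemma rhs_continuous:
  assumes "continuous_on {t0..} z"
  shows "continuous_on {t0..} (\<lambda>t. rhs t (z t))"
  unfolding rhs_def using t0 assms
  by (intro continuous_intros G_continuous) auto

lemma rhs_lipschitz: "\<exists>K>0. \<forall>t\<in>{t0..T}. \<forall>z w. norm (rhs t z - rhs t w) \<le> K * norm (z - w)"
proof -
  obtain L where L: "L \<ge> 0" "\<forall>t\<in>{t0..T}. \<forall>s\<in>{t0..T}. \<forall>x y.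
      norm (G t x - G s y) \<le> L * (norm (x - y) + \<bar>t - s\<bar> * (1 + norm y))"
    using G by blast
  \<comment> \<open>\<open>a\<close> and \<open>b\<close> bound the two coefficients of the second
    component, using 1/t \<le> 1/t0.\<close>
  define a where "a = \<bar>\<alpha>\<bar> / t0"
  define b where "b = \<bar>\<alpha> * \<beta> - \<beta>\<bar> / t0 + 1"
  have ab: "a \<ge> 0" "b \<ge> 0" using t0 by (auto simp: a_def b_def)
  define K where "K = 1 + \<bar>\<beta>\<bar> * L + a + b * L"
  have "norm (rhs t z - rhs t w) \<le> K * norm (z - w)" if t: "t \<in> {t0..T}" for t z w
  proof -
    have tt: "t0 \<le> t" "0 < t" using t t0 by auto
    have ta: "\<bar>\<alpha> / t\<bar> \<le> a"
      using tt t0 by (simp add: a_def abs_divide frac_le)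
    have "\<bar>(\<alpha> * \<beta> - \<beta>) / t - 1\<bar> \<le> \<bar>(\<alpha> * \<beta> - \<beta>) / t\<bar> + 1"
      using abs_triangle_ineq4[of "(\<alpha> * \<beta> - \<beta>) / t" 1] by simp
    moreover have "\<bar>(\<alpha> * \<beta> - \<beta>) / t\<bar> \<le> \<bar>\<alpha> * \<beta> - \<beta>\<bar> / t0"
      using tt t0 by (simp only: abs_divide) (simp add: frac_le)
    ultimately have tb: "\<bar>(\<alpha> * \<beta> - \<beta>) / t - 1\<bar> \<le> b" by (simp add: b_def)
    define d where "d = norm (z - w)"
    have d: "d \<ge> 0" "norm (fst z - fst w) \<le> d" "norm (snd z - snd w) \<le> d"
      using norm_fst_le[of "fst (z - w)" "snd (z - w)"] norm_snd_le[of "snd (z - w)" "fst (z - w)"]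
      unfolding d_def prod.collapse by simp_all
    define g where "g = G t (fst z) - G t (fst w)"
    have "norm g \<le> L * norm (fst z - fst w)"
      using L(2)[rule_format, OF t t, of "fst z" "fst w"] by (simp add: g_def)
    also have "\<dots> \<le> L * d" using d L(1) by (intro mult_left_mono)
    finally have g: "norm g \<le> L * d" .
    have "rhs t z - rhs t w = ((snd z - snd w) - \<beta> *\<^sub>R g,
        (- (\<alpha> / t)) *\<^sub>R (snd z - snd w) + ((\<alpha> * \<beta> - \<beta>) / t - 1) *\<^sub>R g)"
      by (simp add: rhs_def g_def scaleR_diff_right)
    also have "norm \<dots> \<le> norm ((snd z - snd w) - \<beta> *\<^sub>R g)
        + norm ((- (\<alpha> / t)) *\<^sub>R (snd z - snd w) + ((\<alpha> * \<beta> - \<beta>) / t - 1) *\<^sub>R g)"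
      by (rule norm_Pair_le)
    also have "\<dots> \<le> (norm (snd z - snd w) + norm (\<beta> *\<^sub>R g))
        + (norm ((- (\<alpha> / t)) *\<^sub>R (snd z - snd w)) + norm (((\<alpha> * \<beta> - \<beta>) / t - 1) *\<^sub>R g))"
      by (rule add_mono[OF norm_triangle_ineq4 norm_triangle_ineq])
    also have "\<dots> = (norm (snd z - snd w) + \<bar>\<beta>\<bar> * norm g)
        + (\<bar>\<alpha> / t\<bar> * norm (snd z - snd w) + \<bar>(\<alpha> * \<beta> - \<beta>) / t - 1\<bar> * norm g)"
      by (simp only: norm_scaleR abs_minus_cancel)
    also have "\<dots> \<le> (d + \<bar>\<beta>\<bar> * (L * d)) + (a * d + b * (L * d))"
      using ta tb d g ab by (intro add_mono mult_mono) auto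
    also have "\<dots> = K * d" by (simp add: K_def algebra_simps)
    finally show ?thesis by (simp add: d_def)
  qed
  moreover have "K > 0" using L(1) ab by (simp add: K_def add_pos_nonneg)
  ultimately show ?thesis by blast
qed

definition solution :: "'a \<Rightarrow> 'a \<Rightarrow> (real \<Rightarrow> 'a) \<Rightarrow> bool" where
  "solution x0 v0 x \<longleftrightarrow>
     loc_abs_continuous_from t0 x \<and>
     (\<exists>v. loc_abs_continuous_from t0 v \<and>
        (AE t in lebesgue. t \<ge> t0 \<longrightarrow> (x has_vector_derivative v t) (at t within {t0..})) \<and>
        x t0 = x0 \<and> v t0 = v0 \<and>
        (AE t in lebesgue. t \<ge> t0 \<longrightarrow>
          (\<exists>w g. (v has_vector_derivative w) (at t within {t0..}) \<and>
             ((\<lambda>s. G s (x s)) has_vector_derivative g) (at t within {t0..}) \<and>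
             w + (\<alpha> / t) *\<^sub>R v t + \<beta> *\<^sub>R g + (1 + \<beta> / t) *\<^sub>R G t (x t) = 0)))"

text \<open>Eliminates the velocity v = u - \<beta> G from the terms without second-order
  derivatives; both directions of the equivalence rely on it.\<close>

lemma first_order_field_eq:
  assumes "t > 0" "v = u - \<beta> *\<^sub>R g"
  shows "- ((\<alpha> / t) *\<^sub>R v + (1 + \<beta> / t) *\<^sub>R g) = (- (\<alpha> / t)) *\<^sub>R u + ((\<alpha> * \<beta> - \<beta>) / t - 1) *\<^sub>R (g :: 'a)"
proof -
  have "(\<alpha> * \<beta> - \<beta>) / t - 1 = \<alpha> / t * \<beta> - (1 + \<beta> / t)"
    by (simp add: diff_divide_distrib)
  then show ?thesis unfolding assms(2)
    by (simp add: scaleR_diff_right scaleR_diff_left scaleR_add_left)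
qed

lemma solution_exists: "\<exists>x. solution x0 v0 x"
proof -
  \<comment> \<open>The initial value of u compensates the shift, so that v t0 = v0.\<close>
  obtain z where z0: "z t0 = (x0, v0 + \<beta> *\<^sub>R G t0 x0)"
    and z: "\<forall>t\<ge>t0. (z has_vector_derivative rhs t (z t)) (at t within {t0..})"
    using initial_value_problem_exists[where \<Phi>=rhs and ?t0.0=t0 and ?z0.0="(x0, v0 + \<beta> *\<^sub>R G t0 x0)", OF rhs_continuous rhs_lipschitz] by auto
  have zc: "continuous_on {t0..} z"
    using z continuous_on_vector_derivative[of "{t0..}" z "\<lambda>t. rhs t (z t)"] by simp
  define x u where "x t = fst (z t)" and "u t = snd (z t)" for t
  define v where "v t = u t - \<beta> *\<^sub>R G t (x t)" for t
  define u' where "u' t = (- (\<alpha> / t)) *\<^sub>R u t + ((\<alpha> * \<beta> - \<beta>) / t - 1) *\<^sub>R G t (x t)" for t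
  have rhs_eq: "rhs t (z t) = (v t, u' t)" for t by (simp add: rhs_def v_def u'_def x_def u_def)
  have xd: "(x has_vector_derivative v t) (at t within {t0..})" if "t \<ge> t0" for t
    using bounded_linear.has_vector_derivative[OF bounded_linear_fst z[rule_format, OF that]]
    unfolding x_def rhs_eq by simp
  have ud: "(u has_vector_derivative u' t) (at t within {t0..})" if "t \<ge> t0" for t
    using bounded_linear.has_vector_derivative[OF bounded_linear_snd z[rule_format, OF that]]
    unfolding u_def rhs_eq by simp
  have xc: "continuous_on {t0..} x" and uc: "continuous_on {t0..} u"
    unfolding x_def u_def using zc by (auto intro: continuous_intros)
  have vc: "continuous_on {t0..} v"
    unfolding v_def by (intro continuous_intros G_continuous xc uc)
  have u'c: "continuous_on {t0..} u'"
    unfolding u'_def using t0 by (intro continuous_intros G_continuous xc uc) auto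
  have xL: "\<exists>L. L-lipschitz_on {t0..T} x" for T
    by (rule continuous_derivative_imp_lipschitz[OF xd vc])
  have uL: "\<exists>L. L-lipschitz_on {t0..T} u" for T
    by (rule continuous_derivative_imp_lipschitz[OF ud u'c])
  have GL: "\<exists>L. L-lipschitz_on {t0..T} (\<lambda>t. G t (x t))" for T
    by (rule G_lipschitz[OF xL])
  \<comment> \<open>v inherits from G(t, x t) no more than Lipschitz continuity; its derivative is
    available wherever G(t, x t) has one.\<close>
  have vL: "\<exists>L. L-lipschitz_on {t0..T} v" for T
  proof -
    obtain L1 L2 where "L1-lipschitz_on {t0..T} u" "L2-lipschitz_on {t0..T} (\<lambda>t. G t (x t))"
      using uL GL by metis
    then have "(L1 + \<bar>\<beta>\<bar> * L2)-lipschitz_on {t0..T} v"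
      unfolding v_def by (intro lipschitz_on_diff lipschitz_on_cmult) 
    then show ?thesis by blast
  qed
  have "AE t in lebesgue. t \<ge> t0 \<longrightarrow> (\<exists>d. ((\<lambda>t. G t (x t)) has_vector_derivative d) (at t within {t0..}))"
    by (rule locally_lipschitz_has_vector_derivative_ae[OF GL])
  then have "AE t in lebesgue. t \<ge> t0 \<longrightarrow>
          (\<exists>w g. (v has_vector_derivative w) (at t within {t0..}) \<and>
             ((\<lambda>s. G s (x s)) has_vector_derivative g) (at t within {t0..}) \<and>
             w + (\<alpha> / t) *\<^sub>R v t + \<beta> *\<^sub>R g + (1 + \<beta> / t) *\<^sub>R G t (x t) = 0)"
  proof eventually_elim
    case (elim t)
    show ?case
    proof
      assume t: "t \<ge> t0"
      then obtain g where g: "((\<lambda>t. G t (x t)) has_vector_derivative g) (at t within {t0..})"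
        using elim by blast
      have "(v has_vector_derivative u' t - \<beta> *\<^sub>R g) (at t within {t0..})"
        unfolding v_def
        by (intro has_vector_derivative_diff ud[OF t]
            bounded_linear.has_vector_derivative[OF bounded_linear_scaleR_right g])
      moreover have "u' t = - ((\<alpha> / t) *\<^sub>R v t + (1 + \<beta> / t) *\<^sub>R G t (x t))"
        using first_order_field_eq[of t "v t" "u t" "G t (x t)"] t t0 by (simp add: u'_def v_def)
      then have "(u' t - \<beta> *\<^sub>R g) + (\<alpha> / t) *\<^sub>R v t + \<beta> *\<^sub>R g + (1 + \<beta> / t) *\<^sub>R G t (x t) = 0"
        by simp
      ultimately show "\<exists>w g. (v has_vector_derivative w) (at t within {t0..}) \<and>
             ((\<lambda>s. G s (x s)) has_vector_derivative g) (at t within {t0..}) \<and>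
             w + (\<alpha> / t) *\<^sub>R v t + \<beta> *\<^sub>R g + (1 + \<beta> / t) *\<^sub>R G t (x t) = 0"
        using g by (intro exI[of _ "u' t - \<beta> *\<^sub>R g"] exI[of _ g] conjI)
    qed
  qed
  moreover have "AE t in lebesgue. t \<ge> t0 \<longrightarrow> (x has_vector_derivative v t) (at t within {t0..})"
    using xd by simp
  moreover have "x t0 = x0" "v t0 = v0" by (simp_all add: x_def v_def u_def z0)
  ultimately have "solution x0 v0 x"
    unfolding solution_def
    using loc_abs_continuous_from_lipschitz[OF xL] loc_abs_continuous_from_lipschitz[OF vL]
    by (intro conjI exI[of _ v])
  then show ?thesis by (rule exI[where x=x])
qed

text \<open>Separately, w and g may be irregular in t; the equation identifies w + \<beta> g, the
  almost-everywhere derivative of u, with the continuous u'. Absolute continuity of v passes to u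
  because G(t, x t) is locally Lipschitz.\<close>

lemma solution_imp_first_order:
  assumes "solution x0 v0 x"
  shows "\<exists>u. u t0 = v0 + \<beta> *\<^sub>R G t0 x0 \<and> x t0 = x0 \<and>
    (\<forall>t\<ge>t0. ((\<lambda>t. (x t, u t)) has_vector_derivative rhs t (x t, u t)) (at t within {t0..}))"
proof -
  from assms obtain v where xAC: "loc_abs_continuous_from t0 x" and vAC: "loc_abs_continuous_from t0 v"
    and xae: "AE t in lebesgue. t \<ge> t0 \<longrightarrow> (x has_vector_derivative v t) (at t within {t0..})"
    and init: "x t0 = x0" "v t0 = v0"
    and vae: "AE t in lebesgue. t \<ge> t0 \<longrightarrow>
          (\<exists>w g. (v has_vector_derivative w) (at t within {t0..}) \<and>
             ((\<lambda>s. G s (x s)) has_vector_derivative g) (at t within {t0..}) \<and>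
             w + (\<alpha> / t) *\<^sub>R v t + \<beta> *\<^sub>R g + (1 + \<beta> / t) *\<^sub>R G t (x t) = 0)"
    unfolding solution_def by auto
  have vc: "continuous_on {t0..} v" using vAC by (rule loc_abs_continuous_from_imp_continuous_on)
  have xc: "continuous_on {t0..} x" using xAC by (rule loc_abs_continuous_from_imp_continuous_on)
  have xd: "(x has_vector_derivative v t) (at t within {t0..})" if "t \<ge> t0" for t
    by (rule loc_abs_continuous_from_derivative[OF xAC vc xae that])
  have xL: "\<exists>L. L-lipschitz_on {t0..T} x" for T
    by (rule continuous_derivative_imp_lipschitz[OF xd vc])
  define u where "u t = v t + \<beta> *\<^sub>R G t (x t)" for t
  define u' where "u' t = - ((\<alpha> / t) *\<^sub>R v t + (1 + \<beta> / t) *\<^sub>R G t (x t))" for t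
  have "\<exists>L. L-lipschitz_on {t0..T} (\<lambda>t. \<beta> *\<^sub>R G t (x t))" for T
    using G_lipschitz[OF xL, of T] lipschitz_on_cmult by blast
  then have "loc_abs_continuous_from t0 (\<lambda>t. \<beta> *\<^sub>R G t (x t))"
    by (rule loc_abs_continuous_from_lipschitz)
  then have uAC: "loc_abs_continuous_from t0 u"
    using vAC unfolding u_def loc_abs_continuous_from_def by (auto intro: abs_continuous_on_interval_add)
  have u'c: "continuous_on {t0..} u'"
    unfolding u'_def using t0 by (intro continuous_intros G_continuous xc vc) auto
  have uae: "AE t in lebesgue. t \<ge> t0 \<longrightarrow> (u has_vector_derivative u' t) (at t within {t0..})"
    using vae
  proof eventually_elim
    case (elim t)
    show ?case
    proof
      assume "t \<ge> t0"
      then obtain w g where w: "(v has_vector_derivative w) (at t within {t0..})"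
        and g: "((\<lambda>s. G s (x s)) has_vector_derivative g) (at t within {t0..})"
        and eq: "w + (\<alpha> / t) *\<^sub>R v t + \<beta> *\<^sub>R g + (1 + \<beta> / t) *\<^sub>R G t (x t) = 0"
        using elim by blast
      have "(u has_vector_derivative w + \<beta> *\<^sub>R g) (at t within {t0..})"
        unfolding u_def
        by (intro has_vector_derivative_add w
            bounded_linear.has_vector_derivative[OF bounded_linear_scaleR_right g])
      moreover have "(w + \<beta> *\<^sub>R g) + ((\<alpha> / t) *\<^sub>R v t + (1 + \<beta> / t) *\<^sub>R G t (x t)) = 0"
        using eq by (simp add: add_ac)
      then have "w + \<beta> *\<^sub>R g = u' t"
        by (simp only: u'_def eq_neg_iff_add_eq_0)
      ultimately show "(u has_vector_derivative u' t) (at t within {t0..})" by simp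
    qed
  qed
  have "((\<lambda>t. (x t, u t)) has_vector_derivative rhs t (x t, u t)) (at t within {t0..})" if "t \<ge> t0" for t
  proof -
    have "(u has_vector_derivative u' t) (at t within {t0..})"
      by (rule loc_abs_continuous_from_derivative[OF uAC u'c uae that])
    moreover have "rhs t (x t, u t) = (v t, u' t)"
      using first_order_field_eq[of t "v t" "u t" "G t (x t)"] that t0
      by (simp add: rhs_def u_def u'_def)
    ultimately show ?thesis using xd[OF that] by (simp add: has_vector_derivative_Pair)
  qed
  then show ?thesis
    using init by (intro exI[of _ u]) (simp add: u_def)
qed

lemma solution_unique:
  assumes "solution x0 v0 x" "solution x0 v0 y" "t \<ge> t0"
  shows "y t = x t"
proof -
  obtain u where u: "u t0 = v0 + \<beta> *\<^sub>R G t0 x0" "x t0 = x0"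
    "\<forall>t\<ge>t0. ((\<lambda>t. (x t, u t)) has_vector_derivative rhs t (x t, u t)) (at t within {t0..})"
    using solution_imp_first_order[OF assms(1)] by auto
  obtain w where w: "w t0 = v0 + \<beta> *\<^sub>R G t0 x0" "y t0 = x0"
    "\<forall>t\<ge>t0. ((\<lambda>t. (y t, w t)) has_vector_derivative rhs t (y t, w t)) (at t within {t0..})"
    using solution_imp_first_order[OF assms(2)] by auto
  have "(y t, w t) = (x t, u t)"
    by (rule initial_value_problem_unique[of t0 rhs "\<lambda>t. (y t, w t)" "\<lambda>t. (x t, u t)", OF rhs_continuous rhs_lipschitz])
      (use u w assms(3) in auto)
  then show ?thesis by simp
qed

end

section \<open>The scaled Moreau gradients as an instance\<close>

lemma cont_differentiable_on_lipschitz: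
  assumes "cont_differentiable_on {t0..} g"
  shows "\<exists>L. L-lipschitz_on {t0..T} g"
proof -
  obtain g' where g': "\<And>t. t \<in> {t0..} \<Longrightarrow> (g has_real_derivative g' t) (at t within {t0..})"
    and c: "continuous_on {t0..} g'"
    using assms unfolding cont_differentiable_on_def by blast
  show ?thesis
    by (rule continuous_derivative_imp_lipschitz[OF _ c])
      (use g' in \<open>simp add: has_real_derivative_iff_has_vector_derivative\<close>)
qed

text \<open>On a compact interval \<gamma> is bounded below by c > 0 and \<delta> above by D, and
  both are Lipschitz. Dividing the resolvent estimate by c controls the change of the gradient; its
  linear growth pays for changes of \<gamma> and \<delta>.\<close>

lemma moreau_gradient_estimate:
  fixes f :: "'a::{real_inner, complete_space} \<Rightarrow> ereal"
  assumes f: "proper_fun f" "convex_fun f" "lsc_fun f" and z: "z \<in> argmin f"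
    and \<delta>: "\<And>t. t \<ge> t0 \<Longrightarrow> \<delta> t > 0" and \<gamma>: "\<And>t. t \<ge> t0 \<Longrightarrow> \<gamma> t > 0"
    and \<delta>d: "cont_differentiable_on {t0..} \<delta>" and \<gamma>d: "cont_differentiable_on {t0..} \<gamma>"
  shows "\<exists>L\<ge>0. \<forall>t\<in>{t0..T}. \<forall>s\<in>{t0..T}. \<forall>x y.
      norm (\<delta> t *\<^sub>R gradient (moreau_env f (\<gamma> t)) x - \<delta> s *\<^sub>R gradient (moreau_env f (\<gamma> s)) y)
      \<le> L * (norm (x - y) + \<bar>t - s\<bar> * (1 + norm y))"
proof (cases "t0 \<le> T")
  case True
  obtain L\<delta> where L\<delta>: "L\<delta>-lipschitz_on {t0..T} \<delta>" using cont_differentiable_on_lipschitz[OF \<delta>d] by blast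
  obtain L\<gamma> where L\<gamma>: "L\<gamma>-lipschitz_on {t0..T} \<gamma>" using cont_differentiable_on_lipschitz[OF \<gamma>d] by blast
  have L0: "L\<delta> \<ge> 0" "L\<gamma> \<ge> 0" using L\<delta> L\<gamma> by (auto dest: lipschitz_on_nonneg)
  obtain t1 where t1: "t1 \<in> {t0..T}" "\<forall>t\<in>{t0..T}. \<gamma> t1 \<le> \<gamma> t"
    using continuous_attains_inf[of "{t0..T}" \<gamma>] lipschitz_on_continuous_on[OF L\<gamma>] True by auto
  obtain t2 where t2: "t2 \<in> {t0..T}" "\<forall>t\<in>{t0..T}. \<delta> t \<le> \<delta> t2"
    using continuous_attains_sup[of "{t0..T}" \<delta>] lipschitz_on_continuous_on[OF L\<delta>] True by auto
  define c D where "c = \<gamma> t1" and "D = \<delta> t2"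
  have c: "c > 0" "\<And>t. t \<in> {t0..T} \<Longrightarrow> c \<le> \<gamma> t" using t1 \<gamma> by (auto simp: c_def)
  have D: "D > 0" "\<And>t. t \<in> {t0..T} \<Longrightarrow> \<delta> t \<le> D" using t2 \<delta> by (auto simp: D_def)
  define b where "b = (1 + norm z) / c"
  have b: "b \<ge> 0" using c(1) by (simp add: b_def add_nonneg_nonneg)
  \<comment> \<open>D / c comes from moving the point, D L\<gamma> b / c from moving \<gamma>, and
    L\<delta> b from moving \<delta>; b bounds the gradient relative to 1 + norm y.\<close>
  define L where "L = D / c + (D * L\<gamma> * b / c + L\<delta> * b)"
  have "norm (\<delta> t *\<^sub>R gradient (moreau_env f (\<gamma> t)) x - \<delta> s *\<^sub>R gradient (moreau_env f (\<gamma> s)) y)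
      \<le> L * (norm (x - y) + \<bar>t - s\<bar> * (1 + norm y))"
    if t: "t \<in> {t0..T}" and s: "s \<in> {t0..T}" for t s x y
  proof -
    have pos: "\<gamma> t > 0" "\<gamma> s > 0" "\<delta> t > 0" using t s \<gamma> \<delta> by auto
    define A B where "A = yosida f (\<gamma> t) x" and "B = yosida f (\<gamma> s) y"
    have "c * norm B \<le> \<gamma> s * norm B" using c(2)[OF s] by (rule mult_right_mono) simp
    also have "\<dots> \<le> norm (y - z)" unfolding B_def by (rule norm_yosida_le[OF f z pos(2)])
    also have "\<dots> \<le> norm y + norm z" by (rule norm_triangle_ineq4)
    also have "\<dots> \<le> (1 + norm z) * (1 + norm y)" by (simp add: algebra_simps)
    finally have B: "norm B \<le> b * (1 + norm y)" using c(1) by (simp add: b_def field_simps)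
    have "c * norm (A - B) \<le> \<gamma> t * norm (A - B)" using c(2)[OF t] by (rule mult_right_mono) simp
    also have "\<dots> \<le> norm (x - y) + \<bar>\<gamma> t - \<gamma> s\<bar> * norm B"
      unfolding A_def B_def by (rule yosida_diff[OF f z pos(1,2)])
    also have "\<dots> \<le> norm (x - y) + (L\<gamma> * \<bar>t - s\<bar>) * (b * (1 + norm y))"
      using lipschitz_onD[OF L\<gamma> t s] B L0 by (intro add_mono mult_mono) (auto simp: dist_real_def)
    finally have AB: "norm (A - B) \<le> (norm (x - y) + (L\<gamma> * \<bar>t - s\<bar>) * (b * (1 + norm y))) / c"
      using c(1) by (simp add: field_simps)
    have "norm (\<delta> t *\<^sub>R A - \<delta> s *\<^sub>R B) = norm (\<delta> t *\<^sub>R (A - B) + (\<delta> t - \<delta> s) *\<^sub>R B)"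
      by (simp add: algebra_simps)
    also have "\<dots> \<le> \<delta> t * norm (A - B) + \<bar>\<delta> t - \<delta> s\<bar> * norm B"
      using norm_triangle_ineq[of "\<delta> t *\<^sub>R (A - B)" "(\<delta> t - \<delta> s) *\<^sub>R B"] pos(3) by simp
    also have "\<dots> \<le> D * ((norm (x - y) + (L\<gamma> * \<bar>t - s\<bar>) * (b * (1 + norm y))) / c)
        + (L\<delta> * \<bar>t - s\<bar>) * (b * (1 + norm y))"
      using lipschitz_onD[OF L\<delta> t s] D(2)[OF t] D(1) L0 AB B pos(3)
      by (intro add_mono mult_mono) (auto simp: dist_real_def)
    also have "\<dots> = D / c * norm (x - y) + (D * L\<gamma> * b / c + L\<delta> * b) * (\<bar>t - s\<bar> * (1 + norm y))"
      by (simp add: add_divide_distrib algebra_simps)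
    also have "\<dots> \<le> L * norm (x - y) + L * (\<bar>t - s\<bar> * (1 + norm y))"
      using c(1) D(1) L0 b by (intro add_mono mult_right_mono) (auto simp: L_def)
    also have "\<dots> = L * (norm (x - y) + \<bar>t - s\<bar> * (1 + norm y))" by (simp add: distrib_left)
    finally show ?thesis
      by (simp add: A_def B_def gradient_moreau_env[OF f z pos(1)] gradient_moreau_env[OF f z pos(2)])
  qed
  moreover have "L \<ge> 0" using c(1) D(1) L0 b by (simp add: L_def)
  ultimately show ?thesis by (intro exI[of _ L]) simp
qed auto

theorem theorem2p3:
  fixes f :: "'a::{real_inner, complete_space} \<Rightarrow> ereal"
    and \<alpha> \<beta> t0 :: real
    and \<delta> \<gamma> :: "real \<Rightarrow> real"
    and x0 v0 :: 'a
  assumes "proper_fun f" and "convex_fun f" and "lsc_fun f"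
    and "argmin f \<noteq> {}"
    and "\<alpha> > 0" and "\<beta> > 0" and "t0 > 0"
    and "\<And>t. t \<ge> t0 \<Longrightarrow> \<delta> t > 0" and "\<And>t. t \<ge> t0 \<Longrightarrow> \<gamma> t > 0"
    and "cont_differentiable_on {t0..} \<delta>" and "cont_differentiable_on {t0..} \<gamma>"
  shows "\<exists>x. is_solution f \<alpha> \<beta> t0 \<delta> \<gamma> x0 v0 x \<and>
           (\<forall>y. is_solution f \<alpha> \<beta> t0 \<delta> \<gamma> x0 v0 y \<longrightarrow> (\<forall>t\<ge>t0. y t = x t))"
proof -
  obtain z where z: "z \<in> argmin f" using assms(4) by blast
  interpret inertial_system "\<lambda>t x. \<delta> t *\<^sub>R gradient (moreau_env f (\<gamma> t)) x" t0 \<alpha> \<beta>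
  proof
    show "t0 > 0" by fact
  qed (rule moreau_gradient_estimate[OF assms(1-3) z assms(8-11)])
  \<comment> \<open>The two predicates differ in how the scalars 1 + \<beta>/t and \<delta> t are
    grouped.\<close>
  have eq: "is_solution f \<alpha> \<beta> t0 \<delta> \<gamma> x0 v0 y \<longleftrightarrow> solution x0 v0 y" for y
    unfolding is_solution_def solution_def by (simp only: scaleR_scaleR)
  show ?thesis
    unfolding eq using solution_exists solution_unique by blast
qed

end
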